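(* Let $h_1,h_2$ be the channel gains of UT $1$ and UT $2$ on a common (overlapping) beam, with unit power and cross correlation $\rho\in[-1,1]$, and let $\sigma^2>0$ be the noise variance. Let $R_1$ be the secret key rate of UT $1$ on this beam and $R_h$ the corresponding rate when the channels are independent. Then the information leakage ratio $\gamma=(R_h-R_1)/R_h$ is $$\gamma=1-\frac{\log\dfrac{\big((1+\sigma^2)^2-\rho^2\big)^2}{(1+\sigma^2)\big(\sigma^6+3\sigma^4-2\sigma^2\rho^2+2\sigma^2\big)}}{\log\dfrac{(1+\sigma^2)^2}{\sigma^2(2+\sigma^2)}} .$$
   Context: Two user terminals, UT $1$ and UT $2$, occupy the same beam of a base station. Their channel gains $h_1,h_2$ on this beam are zero-mean jointly (circularly symmetric) complex Gaussian random variables with unit power, $\mathbb{E}\{|h_1|^2\}=\mathbb{E}\{|h_2|^2\}=1$, and real cross correlation $\rho=\mathbb{E}\{h_1h_2^*\}$. The noises $n_1^{DL},n_1^{UL},n_2^{DL}$ are zero-mean circularly symmetric complex Gaussian with variance $\sigma^2$, independent of each other and of $(h_1,h_2)$. The observations are $x=h_1+n_1^{DL}$ (UT $1$, downlink), $y=h_1+n_1^{UL}$ (base station, uplink) and $w=h_2+n_2^{DL}$ (UT $2$, downlink; UT $2$ is a curious user). For random variables $z_1,\dots,z_n$ write $\mathcal{R}_{z_1\cdots z_n}=\mathbb{E}\{\mathbf{z}\mathbf{z}^H\}$ with $\mathbf{z}=[z_1,\dots,z_n]^T$. The secret key rate of UT $1$ on the beam is the conditional mutual information $$R_1=I(x;y\mid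 w)=\log\frac{\det(\mathcal{R}_{xw})\det(\mathcal{R}_{yw})}{\det(\mathcal{R}_{xyw})\det(\mathcal{R}_{w})},$$ and $R_h$ is the value of this rate under the independent channel assumption, i.e. when $\rho=0$ (so that it equals $I(x;y)$). *)

theory Defs
  imports "HOL-Probability.Probability"
begin

(* The zero-mean circularly symmetric complex normal law with E |z|^2 = v, i.e. independent
   real and imaginary parts of variance v / 2 each.  For v = 0 it is the point mass at 0; this
   case occurs for linear combinations of fully correlated variables. *)
definition complex_normal :: "real \<Rightarrow> complex measure" where
  "complex_normal v =
     (if v = 0 then return borel 0
      else density lborel (\<lambda>z. ennreal (exp (- (norm z)\<^sup>2 / v) / (pi * v))))"

context prob_space
begin

(* Zero-mean jointly circularly symmetric complex Gaussian: every complex linear combination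
   is zero-mean circularly symmetric complex Gaussian.  A singular covariance is allowed. *)
definition jointly_complex_normal :: "('a \<Rightarrow> complex) \<Rightarrow> ('a \<Rightarrow> complex) \<Rightarrow> bool" where
  "jointly_complex_normal X Y \<longleftrightarrow>
     random_variable borel X \<and> random_variable borel Y \<and>
     (\<forall>a b. \<exists>v\<ge>0. distr M borel (\<lambda>\<omega>. a * X \<omega> + b * Y \<omega>) = complex_normal v)"

end

locale overlapping_beam = prob_space M
  for M :: "'a measure" +
  fixes \<rho> \<sigma> :: real
    and h1 h2 n1_DL n1_UL n2_DL :: "'a \<Rightarrow> complex"
  assumes sigma_pos: "0 < \<sigma>"
    and gains_normal: "jointly_complex_normal h1 h2"
    and gain1_power: "expectation (\<lambda>\<omega>. (norm (h1 \<omega>))\<^sup>2) = 1"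
    and gain2_power: "expectation (\<lambda>\<omega>. (norm (h2 \<omega>))\<^sup>2) = 1"
    and gains_correlation: "expectation (\<lambda>\<omega>. h1 \<omega> * cnj (h2 \<omega>)) = complex_of_real \<rho>"
    and n1_DL_normal: "distr M borel n1_DL = complex_normal (\<sigma>\<^sup>2)"
    and n1_UL_normal: "distr M borel n1_UL = complex_normal (\<sigma>\<^sup>2)"
    and n2_DL_normal: "distr M borel n2_DL = complex_normal (\<sigma>\<^sup>2)"
    (* the pair (h1, h2) and the three noises are mutually independent *)
    and independent:
      "indep_sets
         ((!) [sets (vimage_algebra (space M) (\<lambda>\<omega>. (h1 \<omega>, h2 \<omega>)) borel),
               sets (vimage_algebra (space M) n1_DL borel),
               sets (vimage_algebra (space M) n1_UL borel),
               sets (vimage_algebra (space M) n2_DL borel)]) {..<4}"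
begin

definition x :: "'a \<Rightarrow> complex" where "x \<omega> = h1 \<omega> + n1_DL \<omega>"

definition y :: "'a \<Rightarrow> complex" where "y \<omega> = h1 \<omega> + n1_UL \<omega>"

definition w :: "'a \<Rightarrow> complex" where "w \<omega> = h2 \<omega> + n2_DL \<omega>"

(* I(x; y | w), with logarithms to base b *)
definition secret_key_rate :: "real \<Rightarrow> real" where
  "secret_key_rate b = conditional_mutual_information b borel borel borel x y w"

end

definition leakage_ratio :: "real \<Rightarrow> real \<Rightarrow> real" where
  "leakage_ratio R\<^sub>h R\<^sub>1 = (R\<^sub>h - R\<^sub>1) / R\<^sub>h"

end

theory Submission
  imports Defs
begin

text \<open>
  The law of the gains is only given through linear combinations, and their covariance may be
  singular, so they need not have a joint density.  Linear combinations determine the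
  characteristic function, however, and this is enough: a Gaussian bump
  exp (- |z|^2 / a) is itself a superposition of characters, so by Fubini the
  expectation of a product of two such bumps, centred at the gains, is an explicit Gaussian
  integral of the characteristic function.  As gain and noise are independent, these expectations
  are exactly the densities of the observations.  All densities thus have the form C exp (- Q) with
  Q the quadratic form of the inverse covariance, whose mean is the number of complex variables.
  In the conditional mutual information the means of the forms cancel and only the
  logarithms of the constants C remain.
\<close>

subsection \<open>Gaussian integrals over the complex plane\<close>

text \<open>The rate is a difference of mutual informations, I(x; (y, w)) - I(x; w), taken from the
  laws of the observations, so the quotient of determinants has to be derived. The densities
  involved are those of \<open>x\<close>, \<open>w\<close>, (x, w), (y, w) and (x, y, w); for n
  variables with covariance R the constant is 1 / (pi^n * det R), and the powers of pi cancel in the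
  end. The triple calls for three bumps but there are only two gains. Since \<open>x\<close> and
  \<open>y\<close> observe the same \<open>h1\<close>, the parallelogram identity rewrites their two
  bumps as a factor depending on x - y alone and one bump of width
  \<open>\<sigma>\<^sup>2 / 2\<close> around the midpoint (x + y) / 2. A two-bump formula with
  separate widths \<open>a\<close> and \<open>b\<close> therefore serves the pairs and the triple
  alike. The change of variables to x - y and (x + y) / 2 has determinant 1 and makes x - y
  uncorrelated with the other two variables, which is why the determinant of the triple appears as
  \<open>2 * \<sigma>\<^sup>2 * ((1 + \<sigma>\<^sup>2 / 2) * (1 + \<sigma>\<^sup>2) -
  \<rho>\<^sup>2)\<close>.\<close>

lemma (in pair_sigma_finite) has_bochner_integral_mult:
  fixes f :: "'a \<Rightarrow> 'c::{real_normed_field, banach, second_countable_topology}"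
  assumes f: "has_bochner_integral M1 f a" and g: "has_bochner_integral M2 g b"
  shows "has_bochner_integral (M1 \<Otimes>\<^sub>M M2) (\<lambda>(x, y). f x * g y) (a * b)"
proof -
  have fi: "integrable M1 f" and gi: "integrable M2 g"
    using f g by (auto dest: integrable.intros)
  have int: "integrable (M1 \<Otimes>\<^sub>M M2) (\<lambda>(x, y). f x * g y)"
  proof (rule Fubini_integrable)
    show "integrable M1 (\<lambda>x. \<integral>y. norm (case (x, y) of (x, y) \<Rightarrow> f x * g y) \<partial>M2)"
      using integrable_mult_left[OF integrable_norm[OF fi], of "\<integral>y. norm (g y) \<partial>M2"] by (simp add: norm_mult)
  qed (use fi gi in auto)
  then show ?thesis
    using f g by (auto simp: has_bochner_integral_iff integral_fst'[symmetric])
qed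

text \<open>Lebesgue measure is determined by its values on boxes, and a box in the complex plane is
  a product of two real intervals. Plane integrals thereby become iterated real ones.\<close>

lemma lborel_complex_eq:
  "(lborel :: complex measure) = distr (lborel \<Otimes>\<^sub>M lborel) borel (\<lambda>(x, y). Complex x y)"
proof (rule lborel_eqI)
  have [measurable]: "(\<lambda>(x, y). Complex x y) \<in> borel_measurable (lborel \<Otimes>\<^sub>M lborel)"
    unfolding Complex_eq by measurable
  fix l u :: complex
  assume le: "\<And>b. b \<in> Basis \<Longrightarrow> l \<bullet> b \<le> u \<bullet> b"
  then have *: "Re l \<le> Re u" "Im l \<le> Im u"
    using le[of 1] le[of \<i>] by (auto simp: Basis_complex_def)
  have "(\<lambda>(x, y). Complex x y) -` box l u \<inter> space (lborel \<Otimes>\<^sub>M lborel) = box (Re l) (Re u) \<times> box (Im l) (Im u)"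
    by (auto simp: box_def Basis_complex_def space_pair_measure)
  then show "emeasure (distr (lborel \<Otimes>\<^sub>M lborel) borel (\<lambda>(x, y). Complex x y)) (box l u) = (\<Prod>b\<in>Basis. (u - l) \<bullet> b)"
    using * by (simp add: emeasure_distr lborel.emeasure_pair_measure_Times Basis_complex_def ennreal_mult)
qed simp

lemma borel_measurable_Complex [measurable (raw)]:
  assumes [measurable]: "f \<in> borel_measurable M" "g \<in> borel_measurable M"
  shows "(\<lambda>x. Complex (f x) (g x)) \<in> borel_measurable M"
  unfolding Complex_eq by measurable

lemma borel_measurable_cnj [measurable (raw)]:
  "f \<in> borel_measurable M \<Longrightarrow> (\<lambda>x. cnj (f x)) \<in> borel_measurable M"
  by (rule borel_measurable_continuous_on[of cnj]) (auto intro!: continuous_on_cnj continuous_on_id)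

lemma has_bochner_integral_lborel_complexI:
  fixes f :: "complex \<Rightarrow> 'b::{banach, second_countable_topology}"
  assumes [measurable]: "f \<in> borel_measurable borel"
    and "has_bochner_integral (lborel \<Otimes>\<^sub>M lborel) (\<lambda>(x, y). f (Complex x y)) a"
  shows "has_bochner_integral lborel f a"
  using assms(2) by (subst lborel_complex_eq, intro has_bochner_integral_distr) (auto simp: split_beta')

text \<open>No contour shift is needed: the real part of \<open>\<beta>\<close> is absorbed by
  translating to the centre \<open>t0\<close>, and the imaginary part is handled by the
  characteristic function of the standard normal law. The scale \<open>c\<close> is chosen so that
  \<alpha> c^2 = 1/2.\<close>

lemma has_bochner_integral_exp_quadratic:
  fixes \<alpha> :: real and \<beta> :: complex
  assumes \<alpha>: "0 < \<alpha>"
  shows "has_bochner_integral lborel (\<lambda>t::real. exp (- of_real (\<alpha> * t\<^sup>2) + \<beta> * of_real t))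
    (of_real (sqrt (pi / \<alpha>)) * exp (\<beta>\<^sup>2 / of_real (4 * \<alpha>)))"
proof -
  define c where "c = 1 / sqrt (2 * \<alpha>)"
  define t0 where "t0 = Re \<beta> / (2 * \<alpha>)"
  define v where "v = Im \<beta>"
  have c: "c > 0" "c\<^sup>2 = 1 / (2 * \<alpha>)" using \<alpha> by (auto simp: c_def power_divide)
  interpret N: real_distribution std_normal_distribution by (rule real_dist_normal_dist)
  have "has_bochner_integral std_normal_distribution (\<lambda>x. iexp (v * c * x)) (of_real (exp (- (v * c)\<^sup>2 / 2)))"
    using fun_cong[OF char_std_normal_distribution, of "v * c"] unfolding char_def
    by (auto simp: has_bochner_integral_iff intro!: N.integrable_iexp)
  then have "has_bochner_integral lborel (\<lambda>x. std_normal_density x *\<^sub>R iexp (v * c * x)) (of_real (exp (- (v * c)\<^sup>2 / 2)))"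
    by (auto simp: has_bochner_integral_iff integral_density integrable_density)
  \<comment> \<open>The factor undoes the normalisation of the normal density and restores the
    constant \<open>\<alpha> * t0\<^sup>2 + \<i> * v * t0\<close> that remains after completing the
    square.\<close>
  from has_bochner_integral_mult_right[OF this, of "of_real (sqrt (2 * pi)) * exp (of_real (\<alpha> * t0\<^sup>2) + \<i> * v * t0)"]
  have *: "has_bochner_integral lborel (\<lambda>x. of_real (sqrt (2 * pi)) * exp (of_real (\<alpha> * t0\<^sup>2) + \<i> * v * t0) * (std_normal_density x *\<^sub>R iexp (v * c * x)))
     (of_real (sqrt (2 * pi)) * exp (of_real (\<alpha> * t0\<^sup>2) + \<i> * v * t0) * (of_real (exp (- (v * c)\<^sup>2 / 2))))" .
  have t0: "Re \<beta> = 2 * \<alpha> * t0" using \<alpha> by (simp add: t0_def)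
  have f: "of_real (sqrt (2 * pi)) * exp (of_real (\<alpha> * t0\<^sup>2) + \<i> * v * t0) * (std_normal_density x *\<^sub>R iexp (v * c * x))
     = exp (- of_real (\<alpha> * (t0 + c * x)\<^sup>2) + \<beta> * of_real (t0 + c * x))" for x
  proof -
    have b: "\<beta> = of_real (2 * \<alpha> * t0) + \<i> * of_real v" by (simp add: complex_eq_iff t0 v_def)
    have e: "\<alpha> * (c * x)\<^sup>2 = x\<^sup>2 / 2" using c \<alpha> by (simp add: power_mult_distrib)
    have "of_real (sqrt (2 * pi)) * exp (of_real (\<alpha> * t0\<^sup>2) + \<i> * v * t0) * (std_normal_density x *\<^sub>R iexp (v * c * x))
      = exp (of_real (\<alpha> * t0\<^sup>2) + \<i> * v * t0) * of_real (exp (- x\<^sup>2 / 2)) * iexp (v * c * x)"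
      by (simp add: std_normal_density_def scaleR_conv_of_real)
    also have "\<dots> = exp (of_real (\<alpha> * t0\<^sup>2) + \<i> * v * t0 + of_real (- x\<^sup>2 / 2) + \<i> * (v * c * x))"
      by (simp only: exp_add exp_of_real of_real_mult)
    also have "of_real (\<alpha> * t0\<^sup>2) + \<i> * v * t0 + of_real (- x\<^sup>2 / 2) + \<i> * (v * c * x) =
       - of_real (\<alpha> * (t0 + c * x)\<^sup>2) + \<beta> * of_real (t0 + c * x)"
    proof -
      have "x\<^sup>2 / 2 = \<alpha> * (c * x)\<^sup>2" using e by simp
      then have "- x\<^sup>2 / 2 = - (\<alpha> * (c * x)\<^sup>2)" by simp
      then show ?thesis unfolding b
        by (simp only: of_real_mult of_real_add of_real_power of_real_minus) (simp add: algebra_simps power2_eq_square)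
    qed
    finally show ?thesis .
  qed
  \<comment> \<open>The division by |c| anticipates the Jacobian of the substitution t = t0 + c
    x.\<close>
  have r: "of_real (sqrt (2 * pi)) * exp (of_real (\<alpha> * t0\<^sup>2) + \<i> * v * t0) * (of_real (exp (- (v * c)\<^sup>2 / 2)))
     = (of_real (sqrt (pi / \<alpha>)) * exp (\<beta>\<^sup>2 / of_real (4 * \<alpha>))) /\<^sub>R \<bar>c\<bar>"
  proof -
    have s: "sqrt (pi / \<alpha>) / c = sqrt (2 * pi)"
      using \<alpha> by (simp add: c_def real_sqrt_mult real_sqrt_divide)
    have b: "\<beta>\<^sup>2 / of_real (4 * \<alpha>) = of_real (\<alpha> * t0\<^sup>2) + \<i> * v * t0 + of_real (- (v * c)\<^sup>2 / 2)"
      using \<alpha> by (simp add: complex_eq_iff t0 v_def[symmetric] power_mult_distrib c(2))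
        (simp add: v_def t0 power2_eq_square field_simps)
    have "exp (\<beta>\<^sup>2 / of_real (4 * \<alpha>)) = exp (of_real (\<alpha> * t0\<^sup>2) + \<i> * v * t0) * of_real (exp (- (v * c)\<^sup>2 / 2))"
      unfolding b exp_add exp_of_real ..
    then show ?thesis using s c
      by (simp add: scaleR_conv_of_real field_simps flip: of_real_mult s)
  qed
  show ?thesis
    using * unfolding f r
    by (subst lborel_has_bochner_integral_real_affine_iff[where c=c and t=t0]) (use c in auto)
qed

text \<open>The exponent separates in Cartesian coordinates, with linear coefficients \<beta> +
  \<gamma> and i (\<beta> - \<gamma>), whose squares add up to 4 \<beta> \<gamma>. Keeping \<beta>
  and \<gamma> unrelated covers both characters and real shifted Gaussians.\<close>

lemma has_bochner_integral_exp_quadratic_complex: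
  fixes \<alpha> :: real and \<beta> \<gamma> :: complex
  assumes \<alpha>: "0 < \<alpha>"
  shows "has_bochner_integral lborel (\<lambda>z. exp (- of_real (\<alpha> * (norm z)\<^sup>2) + \<beta> * z + \<gamma> * cnj z))
    (of_real (pi / \<alpha>) * exp (\<beta> * \<gamma> / of_real \<alpha>))"
proof -
  let ?f = "\<lambda>t::real. exp (- of_real (\<alpha> * t\<^sup>2) + (\<beta> + \<gamma>) * of_real t)"
  let ?g = "\<lambda>t::real. exp (- of_real (\<alpha> * t\<^sup>2) + \<i> * (\<beta> - \<gamma>) * of_real t)"
  note f = has_bochner_integral_exp_quadratic[OF \<alpha>, of "\<beta> + \<gamma>"]
  note g = has_bochner_integral_exp_quadratic[OF \<alpha>, of "\<i> * (\<beta> - \<gamma>)"]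
  have eq: "exp (- of_real (\<alpha> * (norm (Complex x y))\<^sup>2) + \<beta> * Complex x y + \<gamma> * cnj (Complex x y)) = ?f x * ?g y" for x y
    unfolding exp_add[symmetric]
    by (rule arg_cong[where f=exp]) (simp add: cmod_power2 complex_eq_iff algebra_simps)
  have "has_bochner_integral (lborel \<Otimes>\<^sub>M lborel) (\<lambda>(x, y). ?f x * ?g y)
     ((of_real (sqrt (pi / \<alpha>)) * exp ((\<beta> + \<gamma>)\<^sup>2 / of_real (4 * \<alpha>))) * (of_real (sqrt (pi / \<alpha>)) * exp ((\<i> * (\<beta> - \<gamma>))\<^sup>2 / of_real (4 * \<alpha>))))"
    by (rule lborel_pair.has_bochner_integral_mult[OF f g])
  also have "(of_real (sqrt (pi / \<alpha>)) * exp ((\<beta> + \<gamma>)\<^sup>2 / of_real (4 * \<alpha>))) * (of_real (sqrt (pi / \<alpha>)) * exp ((\<i> * (\<beta> - \<gamma>))\<^sup>2 / of_real (4 * \<alpha>)))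
     = of_real (sqrt (pi / \<alpha>) * sqrt (pi / \<alpha>)) * exp ((\<beta> + \<gamma>)\<^sup>2 / of_real (4 * \<alpha>) + (\<i> * (\<beta> - \<gamma>))\<^sup>2 / of_real (4 * \<alpha>))"
    by (simp only: exp_add of_real_mult ac_simps)
  also have "\<dots> = of_real (pi / \<alpha>) * exp (\<beta> * \<gamma> / of_real \<alpha>)"
    using \<alpha> by (simp add: field_simps power2_eq_square)
  finally show ?thesis
    by (intro has_bochner_integral_lborel_complexI) (simp_all only: eq, measurable)
qed

subsection \<open>The complex normal law\<close>

text \<open>Real and imaginary part carry half of the variance each; this gives access to the
  moments of real normal densities.\<close>

lemma exp_norm_square_eq_normal_density:
  assumes "0 < v"
  shows "exp (- (norm (Complex x y))\<^sup>2 / v) / (pi * v) = normal_density 0 (sqrt (v / 2)) x * normal_density 0 (sqrt (v / 2)) y"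
proof -
  have "2 * pi * (sqrt (v / 2))\<^sup>2 = pi * v" "2 * (sqrt (v / 2))\<^sup>2 = v"
    using assms by simp_all
  moreover have "exp (- (norm (Complex x y))\<^sup>2 / v) = exp (- x\<^sup>2 / v) * exp (- y\<^sup>2 / v)"
    by (simp add: cmod_power2 add_divide_distrib diff_divide_distrib flip: exp_add)
  moreover have "pi * v = sqrt (pi * v) * sqrt (pi * v)"
    using assms by simp
  ultimately show ?thesis
    by (simp add: normal_density_def)
qed

lemma has_bochner_integral_complex_normalI:
  fixes f :: "complex \<Rightarrow> 'b::{banach, second_countable_topology}"
  assumes v: "0 < v" and [measurable]: "f \<in> borel_measurable borel"
    and "has_bochner_integral lborel (\<lambda>z. (exp (- (norm z)\<^sup>2 / v) / (pi * v)) *\<^sub>R f z) a"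
  shows "has_bochner_integral (complex_normal v) f a"
  using assms(3) v
  unfolding complex_normal_def by (auto intro!: has_bochner_integral_density)

lemma has_bochner_integral_complex_normal_return:
  fixes f :: "complex \<Rightarrow> 'b::{banach, second_countable_topology}"
  assumes [measurable]: "f \<in> borel_measurable borel"
  shows "has_bochner_integral (complex_normal 0) f (f 0)"
  unfolding complex_normal_def
  by (auto simp: has_bochner_integral_iff integral_return integrable_iff_bounded nn_integral_return)

text \<open>Each coordinate contributes v / 2. The result lets the parameter of a complex normal law
  be recovered as its second absolute moment.\<close>

lemma has_bochner_integral_complex_normal_norm_square:
  assumes v: "0 \<le> v"
  shows "has_bochner_integral (complex_normal v) (\<lambda>z. (norm z)\<^sup>2) v"
proof (cases "v = 0")
  case False
  let ?n = "normal_density 0 (sqrt (v / 2))"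
  from False v have v: "0 < v" by simp
  then have s: "0 < sqrt (v / 2)" by simp
  have 0: "has_bochner_integral lborel ?n 1"
    using s integral_normal_density integrable_normal_density by (auto simp: has_bochner_integral_iff)
  have 2: "has_bochner_integral lborel (\<lambda>x. ?n x * x\<^sup>2) (v / 2)"
    using normal_moment_even[OF s, of 0 1] v by simp
  have "has_bochner_integral (lborel \<Otimes>\<^sub>M lborel)
     (\<lambda>p. (case p of (x, y) \<Rightarrow> ?n x * x\<^sup>2 * ?n y) + (case p of (x, y) \<Rightarrow> ?n x * (?n y * y\<^sup>2))) (v / 2 * 1 + 1 * (v / 2))"
    by (intro has_bochner_integral_add lborel_pair.has_bochner_integral_mult 0 2)
  then have "has_bochner_integral (lborel \<Otimes>\<^sub>M lborel)
     (\<lambda>(x, y). (exp (- (norm (Complex x y))\<^sup>2 / v) / (pi * v)) *\<^sub>R (norm (Complex x y))\<^sup>2) v"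
    unfolding exp_norm_square_eq_normal_density[OF v]
    by (simp add: cmod_power2 split_beta' algebra_simps)
  then show ?thesis
    by (intro has_bochner_integral_complex_normalI[OF v] has_bochner_integral_lborel_complexI) auto
qed (use has_bochner_integral_complex_normal_return[of "\<lambda>z. (norm z)\<^sup>2"] in simp)

lemma integral_complex_normal_ident:
  assumes v: "0 < v"
  shows "integral\<^sup>L (complex_normal v) (\<lambda>z. z) = 0"
proof -
  let ?n = "normal_density 0 (sqrt (v / 2))"
  from v have s: "0 < sqrt (v / 2)" by simp
  have 0: "has_bochner_integral lborel (\<lambda>x. of_real (?n x)) (of_real 1 :: complex)"
    using s integral_normal_density integrable_normal_density by (intro has_bochner_integral_of_real) (auto simp: has_bochner_integral_iff)
  have 1: "has_bochner_integral lborel (\<lambda>x. of_real (?n x * x)) (of_real 0 :: complex)"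
    using normal_moment_odd[OF s, of 0 0] v by (intro has_bochner_integral_of_real) simp
  have "has_bochner_integral (lborel \<Otimes>\<^sub>M lborel)
     (\<lambda>p. (case p of (x, y) \<Rightarrow> of_real (?n x * x) * of_real (?n y)) + \<i> * (case p of (x, y) \<Rightarrow> of_real (?n x) * of_real (?n y * y)))
     (of_real 0 * of_real 1 + \<i> * (of_real 1 * of_real 0))"
    by (intro has_bochner_integral_add has_bochner_integral_mult_right lborel_pair.has_bochner_integral_mult 0 1)
  then have "has_bochner_integral (lborel \<Otimes>\<^sub>M lborel)
     (\<lambda>(x, y). (exp (- (norm (Complex x y))\<^sup>2 / v) / (pi * v)) *\<^sub>R Complex x y) 0"
    unfolding exp_norm_square_eq_normal_density[OF v]
    by (simp add: Complex_eq split_beta' algebra_simps scaleR_conv_of_real)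
  then have "has_bochner_integral (complex_normal v) (\<lambda>z. z) 0"
    by (intro has_bochner_integral_complex_normalI[OF v] has_bochner_integral_lborel_complexI) auto
  then show ?thesis by (rule has_bochner_integral_integral_eq)
qed

text \<open>Writing Re z = (z + cnj z) / 2 puts the character into the Gaussian integral with both
  linear coefficients equal to i / 2. The direction of the real part suffices, because linear
  combinations with arbitrary complex coefficients reach every other direction.\<close>

lemma integral_complex_normal_iexp_Re:
  assumes v: "0 \<le> v"
  shows "integral\<^sup>L (complex_normal v) (\<lambda>z. iexp (Re z)) = exp (of_real (- v / 4))"
proof (cases "v = 0")
  case False
  from False v have v: "0 < v" by simp
  have "has_bochner_integral lborel (\<lambda>z. of_real (1 / (pi * v)) * exp (- of_real (1 / v * (norm z)\<^sup>2) + \<i> / 2 * z + \<i> / 2 * cnj z))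
    (of_real (1 / (pi * v)) * (of_real (pi / (1 / v)) * exp (\<i> / 2 * (\<i> / 2) / of_real (1 / v))))"
    using v by (intro has_bochner_integral_mult_right has_bochner_integral_exp_quadratic_complex) auto
  also have "(of_real (1 / (pi * v)) * (of_real (pi / (1 / v)) * exp (\<i> / 2 * (\<i> / 2) / of_real (1 / v)))) = exp (of_real (- v / 4))"
    using v by (simp flip: exp_of_real)
  also have "(\<lambda>z. of_real (1 / (pi * v)) * exp (- of_real (1 / v * (norm z)\<^sup>2) + \<i> / 2 * z + \<i> / 2 * cnj z)) =
    (\<lambda>z. (exp (- (norm z)\<^sup>2 / v) / (pi * v)) *\<^sub>R iexp (Re z))"
  proof
    fix z
    have *: "- of_real (1 / v * (norm z)\<^sup>2) + \<i> / 2 * z + \<i> / 2 * cnj z = of_real (- (norm z)\<^sup>2 / v) + \<i> * Re z"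
      by (simp add: complex_eq_iff)
    show "of_real (1 / (pi * v)) * exp (- of_real (1 / v * (norm z)\<^sup>2) + \<i> / 2 * z + \<i> / 2 * cnj z) =
      (exp (- (norm z)\<^sup>2 / v) / (pi * v)) *\<^sub>R iexp (Re z)"
      unfolding * exp_add exp_of_real by (simp add: scaleR_conv_of_real)
  qed
  finally show ?thesis
    by (intro has_bochner_integral_integral_eq has_bochner_integral_complex_normalI[OF v]) auto
qed (use has_bochner_integral_complex_normal_return[of "\<lambda>z. iexp (Re z)"] in \<open>simp add: has_bochner_integral_iff\<close>)

subsection \<open>Gaussian smoothing\<close>

text \<open>For a fixed value of \<open>H\<close> the sum is a translate of \<open>N\<close>;
  averaging the translated density over \<open>H\<close> with Tonelli gives a density of the sum.
  The law of \<open>H\<close> may be singular, as it is for fully correlated gains.\<close>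

lemma (in prob_space) distributed_add_indep:
  fixes H N :: "'a \<Rightarrow> 'e::euclidean_space"
  assumes indep: "indep_var borel H borel N" and N: "distributed M lborel N f"
  shows "distributed M lborel (\<lambda>\<omega>. H \<omega> + N \<omega>) (\<lambda>z. \<integral>\<^sup>+\<omega>. f (z - H \<omega>) \<partial>M)"
proof -
  have [measurable]: "H \<in> borel_measurable M" "N \<in> borel_measurable M" "f \<in> borel_measurable borel"
    using indep_var_rv1[OF indep] indep_var_rv2[OF indep] distributed_borel_measurable[OF N] by auto
  interpret N: prob_space "distr M borel N"
    by (rule prob_space_distr) simp
  have N': "distr M borel N = density lborel f"
    using distributed_distr_eq_density[OF N] by (simp cong: distr_cong)
  interpret Q: pair_sigma_finite M "lborel :: 'e measure" ..
  have "distr M lborel (\<lambda>\<omega>. H \<omega> + N \<omega>) = density lborel (\<lambda>z. \<integral>\<^sup>+\<omega>. f (z - H \<omega>) \<partial>M)"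
  proof (rule measure_eqI)
    fix A assume "A \<in> sets (distr M lborel (\<lambda>\<omega>. H \<omega> + N \<omega>))"
    then have [measurable]: "A \<in> sets borel" by simp
    have "emeasure (distr M lborel (\<lambda>\<omega>. H \<omega> + N \<omega>)) A = (\<integral>\<^sup>+z. indicator A z \<partial>distr M lborel (\<lambda>\<omega>. H \<omega> + N \<omega>))"
      by simp
    also have "\<dots> = (\<integral>\<^sup>+\<omega>. indicator A (H \<omega> + N \<omega>) \<partial>M)"
      by (subst nn_integral_distr) auto
    also have "\<dots> = (\<integral>\<^sup>+p. indicator A (fst p + snd p) \<partial>distr M (borel \<Otimes>\<^sub>M borel) (\<lambda>\<omega>. (H \<omega>, N \<omega>)))"
      by (subst nn_integral_distr) auto
    also have "\<dots> = (\<integral>\<^sup>+p. indicator A (fst p + snd p) \<partial>(distr M borel H \<Otimes>\<^sub>M distr M borel N))"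
      using indep unfolding indep_var_distribution_eq by simp
    also have "\<dots> = (\<integral>\<^sup>+h. \<integral>\<^sup>+n. indicator A (h + n) \<partial>distr M borel N \<partial>distr M borel H)"
      by (subst N.nn_integral_fst[symmetric]) (auto cong: measurable_cong_sets)
    also have "\<dots> = (\<integral>\<^sup>+\<omega>. \<integral>\<^sup>+n. indicator A (H \<omega> + n) \<partial>distr M borel N \<partial>M)"
      by (rule nn_integral_distr) auto
    also have "\<dots> = (\<integral>\<^sup>+\<omega>. \<integral>\<^sup>+z. f (z - H \<omega>) * indicator A z \<partial>lborel \<partial>M)"
    proof (rule nn_integral_cong)
      fix \<omega>
      have "(\<integral>\<^sup>+n. indicator A (H \<omega> + n) \<partial>distr M borel N) = (\<integral>\<^sup>+n. f n * indicator A (H \<omega> + n) \<partial>lborel)"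
        unfolding N' by (subst nn_integral_density) auto
      also have "\<dots> = (\<integral>\<^sup>+z. f (z - H \<omega>) * indicator A z \<partial>distr lborel borel ((+) (H \<omega>)))"
        by (subst nn_integral_distr) auto
      finally show "(\<integral>\<^sup>+n. indicator A (H \<omega> + n) \<partial>distr M borel N) = (\<integral>\<^sup>+z. f (z - H \<omega>) * indicator A z \<partial>lborel)"
        by (simp add: lborel_distr_plus)
    qed
    also have "\<dots> = (\<integral>\<^sup>+z. \<integral>\<^sup>+\<omega>. f (z - H \<omega>) * indicator A z \<partial>M \<partial>lborel)"
      by (subst Q.Fubini') auto
    also have "\<dots> = (\<integral>\<^sup>+z. (\<integral>\<^sup>+\<omega>. f (z - H \<omega>) \<partial>M) * indicator A z \<partial>lborel)"
      by (intro nn_integral_cong nn_integral_multc) auto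
    finally show "emeasure (distr M lborel (\<lambda>\<omega>. H \<omega> + N \<omega>)) A = emeasure (density lborel (\<lambda>z. \<integral>\<^sup>+\<omega>. f (z - H \<omega>) \<partial>M)) A"
      by (subst emeasure_density) auto
  qed simp
  then show ?thesis
    unfolding distributed_def by auto
qed

text \<open>
  Here F r z is the integrand whose integral over the plane is a multiple of
  exp (- |z|^2 / r); the factors 1 / 4 and 1 / 2 come from the normalisation of the
  characteristic function by exp (- v / 4).
\<close>

lemma (in prob_space) expectation_exp_quadratic_pair:
  fixes X Y :: "'a \<Rightarrow> complex" and a b \<rho> :: real and u v :: complex
  assumes [measurable]: "random_variable borel X" "random_variable borel Y"
    and char: "\<And>s t. expectation (\<lambda>\<omega>. iexp (Re (cnj s * X \<omega> + cnj t * Y \<omega>))) =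
      exp (of_real (- ((norm s)\<^sup>2 + (norm t)\<^sup>2 + 2 * \<rho> * Re (cnj s * t)) / 4))"
    and a: "0 < a" and b: "0 < b" and D: "0 < (1 + a) * (1 + b) - \<rho>\<^sup>2"
  shows "expectation (\<lambda>\<omega>. exp (- ((norm (u - X \<omega>))\<^sup>2 / a) - (norm (v - Y \<omega>))\<^sup>2 / b)) =
    a * b / ((1 + a) * (1 + b) - \<rho>\<^sup>2) *
    exp (- (((1 + b) * (norm u)\<^sup>2 + (1 + a) * (norm v)\<^sup>2 - 2 * \<rho> * Re (u * cnj v)) / ((1 + a) * (1 + b) - \<rho>\<^sup>2)))"
proof -
  define D where "D = (1 + a) * (1 + b) - \<rho>\<^sup>2"
  define F where "F r z s = exp (- of_real (r / 4 * (norm s)\<^sup>2) + (\<i> / 2 * cnj z) * s + (\<i> / 2 * z) * cnj s)"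
    for r :: real and z s :: complex
  have [measurable]: "(\<lambda>x. F r (f x) (g x)) \<in> borel_measurable N"
    if [measurable]: "f \<in> borel_measurable N" "g \<in> borel_measurable N" for r f g and N :: "'x measure"
    unfolding F_def by measurable
  have F: "has_bochner_integral lborel (F r z) (of_real (4 * pi / r) * of_real (exp (- ((norm z)\<^sup>2 / r))))" if "0 < r" for r z
  proof -
    have "has_bochner_integral lborel (F r z) (of_real (pi / (r / 4)) * exp ((\<i> / 2 * cnj z) * (\<i> / 2 * z) / of_real (r / 4)))"
      unfolding F_def using that by (intro has_bochner_integral_exp_quadratic_complex) auto
    also have "(\<i> / 2 * cnj z) * (\<i> / 2 * z) / of_real (r / 4) = of_real (- ((norm z)\<^sup>2 / r))"
      using that complex_norm_square[of z] by (simp add: field_simps)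
    finally show ?thesis by (simp only: exp_of_real) (simp add: field_simps)
  qed
  \<comment> \<open>The linear part of the exponent is purely imaginary, so the modulus is
    independent of the centre. This yields a dominating function free of \<open>\<omega>\<close> for
    Fubini.\<close>
  have norm_F: "norm (F r z s) = norm (F r 0 s)" for r z s
    by (simp add: F_def flip: add_divide_distrib)
  \<comment> \<open>Moving the centre by \<open>h\<close> only multiplies by a character of
    \<open>h\<close>; hence the gains enter through their characteristic function alone.\<close>
  have F_shift: "F r (z - h) s = F r z s * iexp (Re (cnj (- s) * h))" for r z h s
    unfolding F_def exp_add[symmetric]
    by (rule arg_cong[where f=exp]) (simp add: complex_eq_iff algebra_simps add_divide_distrib diff_divide_distrib)
  have FF: "F a (u - X \<omega>) s * F b (v - Y \<omega>) t = F a u s * F b v t * iexp (Re (cnj (- s) * X \<omega> + cnj (- t) * Y \<omega>))" for \<omega> s t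
    unfolding F_shift by (simp add: exp_add[symmetric] algebra_simps)
  interpret Q: pair_sigma_finite M "lborel \<Otimes>\<^sub>M lborel :: (complex \<times> complex) measure" ..
  let ?f = "\<lambda>(\<omega>, s, t). F a (u - X \<omega>) s * F b (v - Y \<omega>) t"
  have int: "integrable (M \<Otimes>\<^sub>M (lborel \<Otimes>\<^sub>M lborel)) ?f"
  proof (rule Bochner_Integration.integrable_bound)
    have "has_bochner_integral M (\<lambda>_. 1 :: complex) 1" by (simp add: has_bochner_integral_iff prob_space)
    from Q.has_bochner_integral_mult[OF this lborel_pair.has_bochner_integral_mult[OF F[OF a, of 0] F[OF b, of 0]]]
    show "integrable (M \<Otimes>\<^sub>M (lborel \<Otimes>\<^sub>M lborel)) (\<lambda>(\<omega>, x). 1 * (case x of (s, t) \<Rightarrow> F a 0 s * F b 0 t))"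
      by (rule integrable.intros)
    show "AE x in M \<Otimes>\<^sub>M lborel \<Otimes>\<^sub>M lborel. norm (?f x) \<le> norm (case x of (\<omega>, x) \<Rightarrow> 1 * (case x of (s, t) \<Rightarrow> F a 0 s * F b 0 t))"
      by (auto simp: norm_mult norm_F[of _ "_ - _"])
  qed measurable
  \<comment> \<open>Taking the expectation adds the covariance of the gains to the diagonal widths
    \<open>a\<close> and \<open>b\<close>: up to the factor 1/4, the quadratic part of
    \<open>G\<close> is now that of the smoothed pair.\<close>
  define G where "G s t = F a u s * F b v t * exp (of_real (- ((norm s)\<^sup>2 + (norm t)\<^sup>2 + 2 * \<rho> * Re (cnj s * t)) / 4))" for s t
  have EG: "expectation (\<lambda>\<omega>. ?f (\<omega>, s, t)) = G s t" for s t
    using char[of "- s" "- t"] by (simp add: FF G_def)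
  have intG: "integrable (lborel \<Otimes>\<^sub>M lborel) (\<lambda>(s, t). G s t)"
    using Q.integrable_snd[of "\<lambda>\<omega> x. ?f (\<omega>, x)"] int EG by (simp add: split_beta')
  \<comment> \<open>Integrating out \<open>t\<close> leaves the Schur complement D / (1 + b) as the
    coefficient of |s|^2 and replaces \<open>u\<close> by its residual after regression on
    \<open>v\<close>.\<close>
  have inner: "(\<integral>t. G s t \<partial>lborel) = of_real (4 * pi / (1 + b)) * exp (- of_real ((norm v)\<^sup>2 / (1 + b))) *
     exp (- of_real (D / (4 * (1 + b)) * (norm s)\<^sup>2) + \<i> / 2 * cnj (u - \<rho> / (1 + b) * v) * s + \<i> / 2 * (u - \<rho> / (1 + b) * v) * cnj s)" for s
  proof -
    have Geq: "G s t = F (a + 1) u s * exp (- of_real ((1 + b) / 4 * (norm t)\<^sup>2) + (\<i> / 2 * cnj v - \<rho> / 4 * cnj s) * t + (\<i> / 2 * v - \<rho> / 4 * s) * cnj t)" for t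
      unfolding F_def G_def exp_add[symmetric] by (rule arg_cong[where f=exp]) (simp add: complex_eq_iff field_simps)
    have "(\<integral>t. G s t \<partial>lborel) = F (a + 1) u s * (of_real (pi / ((1 + b) / 4)) * exp ((\<i> / 2 * cnj v - \<rho> / 4 * cnj s) * (\<i> / 2 * v - \<rho> / 4 * s) / of_real ((1 + b) / 4)))"
      unfolding Geq using b
      by (intro has_bochner_integral_integral_eq has_bochner_integral_mult_right has_bochner_integral_exp_quadratic_complex) auto
    also have "\<dots> = of_real (4 * pi / (1 + b)) * exp ((- of_real ((a + 1) / 4 * (norm s)\<^sup>2) + (\<i> / 2 * cnj u) * s + (\<i> / 2 * u) * cnj s) +
         (\<i> / 2 * cnj v - \<rho> / 4 * cnj s) * (\<i> / 2 * v - \<rho> / 4 * s) / of_real ((1 + b) / 4))"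
      unfolding F_def exp_add by (simp add: field_simps)
    also have "(- of_real ((a + 1) / 4 * (norm s)\<^sup>2) + (\<i> / 2 * cnj u) * s + (\<i> / 2 * u) * cnj s) +
         (\<i> / 2 * cnj v - \<rho> / 4 * cnj s) * (\<i> / 2 * v - \<rho> / 4 * s) / of_real ((1 + b) / 4) =
       - of_real ((norm v)\<^sup>2 / (1 + b)) + (- of_real (D / (4 * (1 + b)) * (norm s)\<^sup>2) + \<i> / 2 * cnj (u - \<rho> / (1 + b) * v) * s + \<i> / 2 * (u - \<rho> / (1 + b) * v) * cnj s)"
      (is "?l = ?r")
    proof -
      define k where "k = 1 / (1 + b)"
      have k: "\<rho> / (1 + b) = \<rho> * k" "D / (4 * (1 + b)) = (a + 1) / 4 - \<rho>\<^sup>2 * k / 4" "(norm v)\<^sup>2 / (1 + b) = (norm v)\<^sup>2 * k"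
        using b by (simp_all add: k_def D_def field_simps)
      have "z / of_real ((1 + b) / 4) = z * (4 * of_real k)" for z :: complex
        by (simp add: k_def)
      \<comment> \<open>Treating each conjugate as an independent variable makes the completion of
        the square a polynomial identity.\<close>
      moreover have "- (A * (s * s')) + (\<i> / 2 * u') * s + (\<i> / 2 * u) * s' + (\<i> / 2 * v' - r / 4 * s') * (\<i> / 2 * v - r / 4 * s) * (4 * k) =
          - (v * v' * k) + (- ((A - r\<^sup>2 * k / 4) * (s * s')) + \<i> / 2 * (u' - r * k * v') * s + \<i> / 2 * (u - r * k * v) * s')"
        for A k r s s' u u' v v' :: complex
      proof -
        have "\<i> * (\<i> * x) = - x" for x by (simp flip: mult.assoc)
        then have "(\<i> / 2 * v' - r / 4 * s') * (\<i> / 2 * v - r / 4 * s) * (4 * k) =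
            - (v * v' * k) - \<i> / 2 * r * k * (v' * s) - \<i> / 2 * r * k * (v * s') + r\<^sup>2 * k / 4 * (s * s')"
          by (simp add: algebra_simps power2_eq_square)
        then show ?thesis by (simp add: algebra_simps)
      qed
      from this[of "of_real ((a + 1) / 4)" s "cnj s" "cnj u" u "cnj v" "of_real \<rho>" v "of_real k"]
      have "- of_real ((a + 1) / 4 * (norm s)\<^sup>2) + (\<i> / 2 * cnj u) * s + (\<i> / 2 * u) * cnj s +
         (\<i> / 2 * cnj v - \<rho> / 4 * cnj s) * (\<i> / 2 * v - \<rho> / 4 * s) * (4 * of_real k) =
         - of_real ((norm v)\<^sup>2 * k) + (- of_real (((a + 1) / 4 - \<rho>\<^sup>2 * k / 4) * (norm s)\<^sup>2) +
           \<i> / 2 * cnj (u - \<rho> * k * v) * s + \<i> / 2 * (u - \<rho> * k * v) * cnj s)"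
        by (simp add: complex_norm_square[symmetric])
      ultimately show ?thesis by (simp only: k)
    qed
    finally show ?thesis by (simp only: exp_add mult.assoc)
  qed
  have Dp: "0 < D" using D by (simp add: D_def)
  then have D0: "0 < D / (4 * (1 + b))" using b by simp
  \<comment> \<open>The prefactors are the integrals of the two superpositions; they are divided out
    again at the very end.\<close>
  have "of_real (4 * pi / a) * of_real (4 * pi / b) * of_real (expectation (\<lambda>\<omega>. exp (- ((norm (u - X \<omega>))\<^sup>2 / a) - (norm (v - Y \<omega>))\<^sup>2 / b)))
    = expectation (\<lambda>\<omega>. of_real (4 * pi / a) * of_real (4 * pi / b) * of_real (exp (- ((norm (u - X \<omega>))\<^sup>2 / a) - (norm (v - Y \<omega>))\<^sup>2 / b)) :: complex)"
    by simp
  also have "\<dots> = expectation (\<lambda>\<omega>. \<integral>x. ?f (\<omega>, x) \<partial>(lborel \<Otimes>\<^sub>M lborel))"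
  proof (rule Bochner_Integration.integral_cong)
    fix \<omega>
    show "of_real (4 * pi / a) * of_real (4 * pi / b) * of_real (exp (- ((norm (u - X \<omega>))\<^sup>2 / a) - (norm (v - Y \<omega>))\<^sup>2 / b))
       = (\<integral>x. ?f (\<omega>, x) \<partial>(lborel \<Otimes>\<^sub>M lborel))"
      using has_bochner_integral_integral_eq[OF lborel_pair.has_bochner_integral_mult[OF F[OF a, of "u - X \<omega>"] F[OF b, of "v - Y \<omega>"]]]
      by (simp add: exp_diff exp_minus field_simps)
  qed simp
  also have "\<dots> = (\<integral>x. expectation (\<lambda>\<omega>. ?f (\<omega>, x)) \<partial>(lborel \<Otimes>\<^sub>M lborel))"
    using Q.Fubini_integral[of "\<lambda>\<omega> x. ?f (\<omega>, x)"] int by (simp add: split_beta')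
  also have "\<dots> = (\<integral>x. (case x of (s, t) \<Rightarrow> G s t) \<partial>(lborel \<Otimes>\<^sub>M lborel))"
    using EG by (intro Bochner_Integration.integral_cong) auto
  also have "\<dots> = (\<integral>s. \<integral>t. G s t \<partial>lborel \<partial>lborel)"
    using lborel_pair.integral_fst'[OF intG] by simp
  also have "\<dots> = of_real (4 * pi / (1 + b)) * exp (- of_real ((norm v)\<^sup>2 / (1 + b))) *
      (of_real (pi / (D / (4 * (1 + b)))) * exp (\<i> / 2 * cnj (u - \<rho> / (1 + b) * v) * (\<i> / 2 * (u - \<rho> / (1 + b) * v)) / of_real (D / (4 * (1 + b)))))"
    unfolding inner
    by (intro has_bochner_integral_integral_eq has_bochner_integral_mult_right has_bochner_integral_exp_quadratic_complex D0)
  also have "\<dots> = of_real (4 * pi / (1 + b) * (pi / (D / (4 * (1 + b))))) * exp (- of_real ((norm v)\<^sup>2 / (1 + b)) + \<i> / 2 * cnj (u - \<rho> / (1 + b) * v) * (\<i> / 2 * (u - \<rho> / (1 + b) * v)) / of_real (D / (4 * (1 + b))))"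
    unfolding exp_add by simp
  also have "4 * pi / (1 + b) * (pi / (D / (4 * (1 + b)))) = 16 * pi\<^sup>2 / D"
  proof -
    have "4 * pi / q * (pi / (D / (4 * q))) = 16 * pi\<^sup>2 / D" if "q \<noteq> 0" for q
      using that by (simp add: power2_eq_square)
    then show ?thesis using b by (metis add_pos_pos less_irrefl zero_less_one)
  qed
  also have "- of_real ((norm v)\<^sup>2 / (1 + b)) + \<i> / 2 * cnj (u - \<rho> / (1 + b) * v) * (\<i> / 2 * (u - \<rho> / (1 + b) * v)) / of_real (D / (4 * (1 + b)))
    = of_real (- (((1 + b) * (norm u)\<^sup>2 + (1 + a) * (norm v)\<^sup>2 - 2 * \<rho> * Re (u * cnj v)) / D))"
  proof -
    define w where "w = u - \<rho> / (1 + b) * v"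
    have f1: "\<i> / 2 * cnj w * (\<i> / 2 * w) / of_real (D / (4 * (1 + b))) = of_real (- ((norm w)\<^sup>2 * (1 + b) / D))"
      using complex_norm_square[of w] D0 b by (simp add: field_simps)
    \<comment> \<open>This is block inversion of the 2 x 2 covariance: the form of \<open>v\<close>
      alone plus that of the residual \<open>w\<close>, whose variance is the Schur complement D /
      (1 + b).\<close>
    have f2: "(norm v)\<^sup>2 / (1 + b) + (norm w)\<^sup>2 * (1 + b) / D = ((1 + b) * (norm u)\<^sup>2 + (1 + a) * (norm v)\<^sup>2 - 2 * \<rho> * Re (u * cnj v)) / D"
    proof -
      define k where "k = 1 / (1 + b)"
      have k: "k * (1 + b) = 1" "1 / (1 + b) = k" using b by (simp_all add: k_def)
      have w: "w = u - of_real (\<rho> * k) * v" by (simp add: w_def k_def)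
      have w2: "(norm w)\<^sup>2 = (norm u)\<^sup>2 - 2 * \<rho> * k * Re (u * cnj v) + \<rho>\<^sup>2 * k\<^sup>2 * (norm v)\<^sup>2"
        unfolding w cmod_power2 by (simp add: power2_eq_square algebra_simps)
      have "D * k * (norm v)\<^sup>2 + (norm w)\<^sup>2 * (1 + b) = (1 + b) * (norm u)\<^sup>2 + (1 + a) * (norm v)\<^sup>2 - 2 * \<rho> * Re (u * cnj v)"
        using k(1) unfolding w2 D_def by algebra
      moreover have "(norm v)\<^sup>2 / (1 + b) = D * k * (norm v)\<^sup>2 / D"
        using Dp k(2) by (simp flip: k(2))
      ultimately show ?thesis by (metis add_divide_distrib)
    qed
    show ?thesis unfolding w_def[symmetric] f1 f2[symmetric]
      by (simp only: of_real_minus of_real_add minus_add_distrib)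
  qed
  finally have "of_real (16 * pi\<^sup>2 / (a * b) * expectation (\<lambda>\<omega>. exp (- ((norm (u - X \<omega>))\<^sup>2 / a) - (norm (v - Y \<omega>))\<^sup>2 / b)))
     = (of_real (16 * pi\<^sup>2 / D * exp (- (((1 + b) * (norm u)\<^sup>2 + (1 + a) * (norm v)\<^sup>2 - 2 * \<rho> * Re (u * cnj v)) / D))) :: complex)"
    by (simp only: exp_of_real of_real_mult[symmetric]) (simp add: power2_eq_square)
  then have "16 * pi\<^sup>2 / (a * b) * expectation (\<lambda>\<omega>. exp (- ((norm (u - X \<omega>))\<^sup>2 / a) - (norm (v - Y \<omega>))\<^sup>2 / b))
     = 16 * pi\<^sup>2 / D * exp (- (((1 + b) * (norm u)\<^sup>2 + (1 + a) * (norm v)\<^sup>2 - 2 * \<rho> * Re (u * cnj v)) / D))"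
    by (simp only: of_real_eq_iff)
  moreover have "E = a * b / D * R" if "16 * pi\<^sup>2 / (a * b) * E = 16 * pi\<^sup>2 / D * R" for E R
  proof -
    have "E = a * b / (16 * pi\<^sup>2) * (16 * pi\<^sup>2 / (a * b) * E)" using a b by simp
    then show ?thesis unfolding that by simp
  qed
  ultimately show ?thesis unfolding D_def[symmetric] by blast
qed

text \<open>A single gain of unit power has a genuine density, so one bump is averaged directly. The
  new exponent comes from 1/a - 1/(a (1 + a)) = 1/(1 + a).\<close>

lemma has_bochner_integral_complex_normal_exp_quadratic:
  assumes a: "0 < a"
  shows "has_bochner_integral (complex_normal 1) (\<lambda>z. exp (- ((norm (u - z))\<^sup>2 / a))) (a / (1 + a) * exp (- ((norm u)\<^sup>2 / (1 + a))))"
proof -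
  have a1: "0 < 1 + 1 / a" using a by (simp add: add_pos_pos)
  have "has_bochner_integral lborel (\<lambda>z. of_real (exp (- ((norm u)\<^sup>2 / a)) / pi) * exp (- of_real ((1 + 1 / a) * (norm z)\<^sup>2) + of_real (1 / a) * cnj u * z + of_real (1 / a) * u * cnj z))
     (of_real (exp (- ((norm u)\<^sup>2 / a)) / pi) * (of_real (pi / (1 + 1 / a)) * exp (of_real (1 / a) * cnj u * (of_real (1 / a) * u) / of_real (1 + 1 / a))))"
    by (intro has_bochner_integral_mult_right has_bochner_integral_exp_quadratic_complex a1)
  also have "(\<lambda>z. of_real (exp (- ((norm u)\<^sup>2 / a)) / pi) * exp (- of_real ((1 + 1 / a) * (norm z)\<^sup>2) + of_real (1 / a) * cnj u * z + of_real (1 / a) * u * cnj z))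
     = (\<lambda>z. of_real ((exp (- (norm z)\<^sup>2 / 1) / (pi * 1)) * exp (- ((norm (u - z))\<^sup>2 / a))))"
  proof
    fix z
    have 1: "- of_real ((1 + 1 / a) * (norm z)\<^sup>2) + of_real (1 / a) * cnj u * z + of_real (1 / a) * u * cnj z
      = (of_real (- (1 + 1 / a) * (norm z)\<^sup>2 + 2 / a * Re (u * cnj z)) :: complex)"
      by (simp add: complex_eq_iff algebra_simps flip: add_divide_distrib)
    have "- ((norm u)\<^sup>2 / a) + (- (1 + 1 / a) * (norm z)\<^sup>2 + 2 / a * Re (u * cnj z)) = - (norm z)\<^sup>2 - (norm (u - z))\<^sup>2 / a"
      using a unfolding cmod_power2 by (simp add: field_simps power2_eq_square)
    then have "exp (- ((norm u)\<^sup>2 / a)) * exp (- (1 + 1 / a) * (norm z)\<^sup>2 + 2 / a * Re (u * cnj z)) = exp (- (norm z)\<^sup>2) * exp (- ((norm (u - z))\<^sup>2 / a))"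
      by (simp flip: exp_add)
    then show "of_real (exp (- ((norm u)\<^sup>2 / a)) / pi) * exp (- of_real ((1 + 1 / a) * (norm z)\<^sup>2) + of_real (1 / a) * cnj u * z + of_real (1 / a) * u * cnj z)
       = (of_real ((exp (- (norm z)\<^sup>2 / 1) / (pi * 1)) * exp (- ((norm (u - z))\<^sup>2 / a))) :: complex)"
      unfolding 1 exp_of_real of_real_mult[symmetric] of_real_eq_iff by simp
  qed
  also have "of_real (exp (- ((norm u)\<^sup>2 / a)) / pi) * (of_real (pi / (1 + 1 / a)) * exp (of_real (1 / a) * cnj u * (of_real (1 / a) * u) / of_real (1 + 1 / a)))
     = (of_real (a / (1 + a) * exp (- ((norm u)\<^sup>2 / (1 + a)))) :: complex)"
  proof -
    have 1: "of_real (1 / a) * cnj u * (of_real (1 / a) * u) / of_real (1 + 1 / a) = (of_real ((1 / a) * (1 / a) * (norm u)\<^sup>2 / (1 + 1 / a)) :: complex)"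
      unfolding of_real_divide of_real_mult complex_norm_square by simp
    have "1 / a * (1 / a) / (1 + 1 / a) = 1 / a - 1 / (1 + a)"
      using a by (simp add: field_simps)
    then have "- ((norm u)\<^sup>2 / a) + (1 / a) * (1 / a) * (norm u)\<^sup>2 / (1 + 1 / a) = - ((norm u)\<^sup>2 / (1 + a))"
      using times_divide_eq_left[of "1 / a * (1 / a)" "1 + 1 / a" "(norm u)\<^sup>2"] by (simp only: left_diff_distrib) simp
    then have "exp (- ((norm u)\<^sup>2 / a)) * exp ((1 / a) * (1 / a) * (norm u)\<^sup>2 / (1 + 1 / a)) = exp (- ((norm u)\<^sup>2 / (1 + a)))"
      by (simp only: exp_add[symmetric])
    moreover have "1 / (1 + 1 / a) = a / (1 + a)" using a by (simp add: field_simps)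
    moreover have mult_cancel_pi: "p / pi * (pi / d * q) = 1 / d * (p * q)" for p q d :: real
      by simp
    ultimately have "exp (- ((norm u)\<^sup>2 / a)) / pi * (pi / (1 + 1 / a) * exp ((1 / a) * (1 / a) * (norm u)\<^sup>2 / (1 + 1 / a))) = a / (1 + a) * exp (- ((norm u)\<^sup>2 / (1 + a)))"
      using mult_cancel_pi by (simp only:)
    then show ?thesis
      unfolding 1 exp_of_real of_real_mult[symmetric] by simp
  qed
  \<comment> \<open>The computation ran over the complex numbers; taking real parts returns it to
    the real integrand.\<close>
  finally have "has_bochner_integral lborel (\<lambda>z. (exp (- (norm z)\<^sup>2 / 1) / (pi * 1)) * exp (- ((norm (u - z))\<^sup>2 / a))) (a / (1 + a) * exp (- ((norm u)\<^sup>2 / (1 + a))))"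
    using has_bochner_integral_bounded_linear[OF bounded_linear_Re] by fastforce
  then show ?thesis
    by (intro has_bochner_integral_complex_normalI) auto
qed

section \<open>Second moments, characteristic functions and joint densities\<close>

lemma integrable_mult_cnj:
  fixes X Y :: "'a \<Rightarrow> complex"
  assumes [measurable]: "X \<in> borel_measurable M" "Y \<in> borel_measurable M"
    and "integrable M (\<lambda>\<omega>. (norm (X \<omega>))\<^sup>2)" "integrable M (\<lambda>\<omega>. (norm (Y \<omega>))\<^sup>2)"
  shows "integrable M (\<lambda>\<omega>. X \<omega> * cnj (Y \<omega>))"
proof (rule Bochner_Integration.integrable_bound)
  show "integrable M (\<lambda>\<omega>. (norm (X \<omega>))\<^sup>2 + (norm (Y \<omega>))\<^sup>2)"
    using assms by simp
  have "norm p * norm q \<le> (norm p)\<^sup>2 + (norm q)\<^sup>2" for p q :: complex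
    using sum_squares_bound[of "norm p" "norm q"] mult_nonneg_nonneg[OF norm_ge_zero[of p] norm_ge_zero[of q]] by linarith
  then show "AE \<omega> in M. norm (X \<omega> * cnj (Y \<omega>)) \<le> norm ((norm (X \<omega>))\<^sup>2 + (norm (Y \<omega>))\<^sup>2)"
    by (auto simp: norm_mult)
qed measurable

lemma (in prob_space) square_integrable_cmod_imp_integrable:
  fixes f :: "'a \<Rightarrow> complex"
  assumes [measurable]: "f \<in> borel_measurable M" and f: "integrable M (\<lambda>\<omega>. (norm (f \<omega>))\<^sup>2)"
  shows "integrable M f"
proof (rule Bochner_Integration.integrable_bound)
  show "integrable M (\<lambda>\<omega>. 1 + (norm (f \<omega>))\<^sup>2)" using f by simp
  have "norm z \<le> 1 + (norm z)\<^sup>2" for z :: complex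
    using sum_squares_bound[of 1 "norm z"] norm_ge_zero[of z] unfolding one_power2 by linarith
  then show "AE \<omega> in M. norm (f \<omega>) \<le> norm (1 + (norm (f \<omega>))\<^sup>2)" by simp
qed measurable

context prob_space
begin

lemma has_bochner_integral_norm_square_if_complex_normal:
  assumes [measurable]: "random_variable borel Z" and Z: "distr M borel Z = complex_normal v" and v: "0 \<le> v"
  shows "has_bochner_integral M (\<lambda>\<omega>. (norm (Z \<omega>))\<^sup>2) v"
  using has_bochner_integral_complex_normal_norm_square[OF v] unfolding Z[symmetric]
  by (auto simp: has_bochner_integral_iff integrable_distr_eq integral_distr)

text \<open>The parameter that the definition merely asserts to exist is forced to be the second
  absolute moment of the combination, which is thereby finite.\<close>

lemma jointly_complex_normal_lincomb:
  assumes XY: "jointly_complex_normal X Y"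
  shows "integrable M (\<lambda>\<omega>. (norm (a * X \<omega> + b * Y \<omega>))\<^sup>2)"
    and "distr M borel (\<lambda>\<omega>. a * X \<omega> + b * Y \<omega>) = complex_normal (expectation (\<lambda>\<omega>. (norm (a * X \<omega> + b * Y \<omega>))\<^sup>2))"
proof -
  have [measurable]: "random_variable borel X" "random_variable borel Y"
    using XY by (auto simp: jointly_complex_normal_def)
  obtain v where v: "0 \<le> v" "distr M borel (\<lambda>\<omega>. a * X \<omega> + b * Y \<omega>) = complex_normal v"
    using XY by (auto simp: jointly_complex_normal_def)
  note * = has_bochner_integral_norm_square_if_complex_normal[OF _ v(2) v(1)]
  show "integrable M (\<lambda>\<omega>. (norm (a * X \<omega> + b * Y \<omega>))\<^sup>2)"
    using * by (auto simp: has_bochner_integral_iff)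
  show "distr M borel (\<lambda>\<omega>. a * X \<omega> + b * Y \<omega>) = complex_normal (expectation (\<lambda>\<omega>. (norm (a * X \<omega> + b * Y \<omega>))\<^sup>2))"
    using * v by (auto simp: has_bochner_integral_iff)
qed

text \<open>The combination with coefficients \<open>cnj s\<close> and \<open>cnj t\<close> is
  complex normal, and its second moment expands into the two powers and the correlation. The law of
  its real part then gives the value.\<close>

lemma jointly_complex_normal_char:
  assumes XY: "jointly_complex_normal X Y"
    and X2: "expectation (\<lambda>\<omega>. (norm (X \<omega>))\<^sup>2) = 1" and Y2: "expectation (\<lambda>\<omega>. (norm (Y \<omega>))\<^sup>2) = 1"
    and XY': "expectation (\<lambda>\<omega>. X \<omega> * cnj (Y \<omega>)) = of_real \<rho>"
  shows "expectation (\<lambda>\<omega>. iexp (Re (cnj s * X \<omega> + cnj t * Y \<omega>))) =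
    exp (of_real (- ((norm s)\<^sup>2 + (norm t)\<^sup>2 + 2 * \<rho> * Re (cnj s * t)) / 4))"
proof -
  have [measurable]: "random_variable borel X" "random_variable borel Y"
    using XY by (auto simp: jointly_complex_normal_def)
  have i: "integrable M (\<lambda>\<omega>. (norm (X \<omega>))\<^sup>2)" "integrable M (\<lambda>\<omega>. (norm (Y \<omega>))\<^sup>2)"
    using jointly_complex_normal_lincomb(1)[OF XY, of 1 0] jointly_complex_normal_lincomb(1)[OF XY, of 0 1] by auto
  let ?Z = "\<lambda>\<omega>. cnj s * X \<omega> + cnj t * Y \<omega>"
  have "has_bochner_integral M (\<lambda>\<omega>. cnj s * t * (X \<omega> * cnj (Y \<omega>))) (cnj s * t * of_real \<rho>)"
    using integrable_mult_cnj[OF _ _ i] XY' by (intro has_bochner_integral_mult_right) (auto simp: has_bochner_integral_iff)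
  from has_bochner_integral_bounded_linear[OF bounded_linear_Re this]
  have "has_bochner_integral M (\<lambda>\<omega>. (norm s)\<^sup>2 * (norm (X \<omega>))\<^sup>2 + (norm t)\<^sup>2 * (norm (Y \<omega>))\<^sup>2 + 2 * Re (cnj s * t * (X \<omega> * cnj (Y \<omega>))))
     ((norm s)\<^sup>2 * 1 + (norm t)\<^sup>2 * 1 + 2 * Re (cnj s * t * of_real \<rho>))"
    using i X2 Y2 by (intro has_bochner_integral_add has_bochner_integral_mult_right) (auto simp: has_bochner_integral_iff)
  also have "(\<lambda>\<omega>. (norm s)\<^sup>2 * (norm (X \<omega>))\<^sup>2 + (norm t)\<^sup>2 * (norm (Y \<omega>))\<^sup>2 + 2 * Re (cnj s * t * (X \<omega> * cnj (Y \<omega>)))) = (\<lambda>\<omega>. (norm (?Z \<omega>))\<^sup>2)"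
    unfolding cmod_power2 by (simp add: fun_eq_iff power2_eq_square algebra_simps)
  also have "(norm s)\<^sup>2 * 1 + (norm t)\<^sup>2 * 1 + 2 * Re (cnj s * t * of_real \<rho>) = (norm s)\<^sup>2 + (norm t)\<^sup>2 + 2 * \<rho> * Re (cnj s * t)" (is "_ = ?v")
    by (simp add: algebra_simps)
  finally have Z: "has_bochner_integral M (\<lambda>\<omega>. (norm (?Z \<omega>))\<^sup>2) ?v" .
  then have Zv: "expectation (\<lambda>\<omega>. (norm (?Z \<omega>))\<^sup>2) = ?v" by (rule has_bochner_integral_integral_eq)
  \<comment> \<open>Nonnegativity is inherited from the expectation of a square; the value 0, for a
    degenerate combination, is covered by the point mass.\<close>
  have v0: "0 \<le> ?v" unfolding Zv[symmetric] by simp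
  have "expectation (\<lambda>\<omega>. iexp (Re (?Z \<omega>))) = integral\<^sup>L (distr M borel ?Z) (\<lambda>z. iexp (Re z))"
    by (subst integral_distr) auto
  then show ?thesis
    unfolding jointly_complex_normal_lincomb(2)[OF XY] Zv integral_complex_normal_iexp_Re[OF v0] .
qed

text \<open>\<open>indep_var\<close> relates two variables of one common type. The maps
  \<open>f\<close> and \<open>g\<close> let the components have different types afterwards, as
  needed to join a single noise, padded to a pair, with a pair of noises.\<close>

lemma distributed_joint_indep_lborel:
  fixes f :: "'b::topological_space \<Rightarrow> 'c::euclidean_space" and g :: "'b \<Rightarrow> 'd::euclidean_space"
  assumes XY: "indep_var borel X borel Y"
    and [measurable]: "f \<in> borel_measurable borel" "g \<in> borel_measurable borel"
    and X: "distributed M lborel (\<lambda>\<omega>. f (X \<omega>)) p" and Y: "distributed M lborel (\<lambda>\<omega>. g (Y \<omega>)) q"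
  shows "distributed M lborel (\<lambda>\<omega>. (f (X \<omega>), g (Y \<omega>))) (\<lambda>(x, y). p x * q y)"
proof -
  have [measurable]: "X \<in> borel_measurable M" "Y \<in> borel_measurable M"
    using indep_var_rv1[OF XY] indep_var_rv2[OF XY] by auto
  interpret Y: prob_space "distr (distr M borel Y) lborel g"
    by (intro prob_space.prob_space_distr prob_space_distr) auto
  have "distr M lborel (\<lambda>\<omega>. f (X \<omega>)) \<Otimes>\<^sub>M distr M lborel (\<lambda>\<omega>. g (Y \<omega>)) =
      distr (distr M borel X) lborel f \<Otimes>\<^sub>M distr (distr M borel Y) lborel g"
    by (simp add: distr_distr comp_def)
  also have "\<dots> = distr (distr M borel X \<Otimes>\<^sub>M distr M borel Y) (lborel \<Otimes>\<^sub>M lborel) (\<lambda>(x, y). (f x, g y))"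
    by (intro pair_measure_distr Y.sigma_finite_measure_axioms) auto
  also have "\<dots> = distr M (lborel \<Otimes>\<^sub>M lborel) (\<lambda>\<omega>. (f (X \<omega>), g (Y \<omega>)))"
    using XY unfolding indep_var_distribution_eq by (simp add: distr_distr comp_def)
  finally show ?thesis
    using distributed_joint_indep'[OF sigma_finite_lborel sigma_finite_lborel X Y] by (simp add: lborel_prod)
qed

lemma indep_var_mult_cnj:
  fixes X Y :: "'a \<Rightarrow> complex"
  assumes XY: "indep_var borel X borel Y" and "integrable M X" "integrable M Y" "expectation Y = 0"
  shows "has_bochner_integral M (\<lambda>\<omega>. Re (X \<omega> * cnj (Y \<omega>))) 0"
proof -
  have "indep_var borel X borel (\<lambda>\<omega>. cnj (Y \<omega>))"
    using indep_var_compose[OF XY, of "\<lambda>x. x" borel cnj borel] by (simp add: comp_def)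
  then have "has_bochner_integral M (\<lambda>\<omega>. X \<omega> * cnj (Y \<omega>)) 0"
    using indep_var_lebesgue_integral[of X "\<lambda>\<omega>. cnj (Y \<omega>)"] indep_var_integrable[of X "\<lambda>\<omega>. cnj (Y \<omega>)"] assms
    by (simp add: has_bochner_integral_iff)
  from has_bochner_integral_bounded_linear[OF bounded_linear_Re this] show ?thesis by simp
qed

text \<open>Bilinear expansion for gains \<open>A\<close>, \<open>B\<close> and noises
  \<open>N\<close>, \<open>K\<close>. As Re (p * cnj q) is symmetric in p and q, both mixed terms
  can be given with the gain first.\<close>

lemma has_bochner_integral_Re_mult_cnj_add:
  fixes A B N K :: "'a \<Rightarrow> complex"
  assumes "has_bochner_integral M (\<lambda>\<omega>. Re (A \<omega> * cnj (B \<omega>))) c"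
    "has_bochner_integral M (\<lambda>\<omega>. Re (A \<omega> * cnj (K \<omega>))) 0"
    "has_bochner_integral M (\<lambda>\<omega>. Re (B \<omega> * cnj (N \<omega>))) 0"
    "has_bochner_integral M (\<lambda>\<omega>. Re (N \<omega> * cnj (K \<omega>))) d"
  shows "has_bochner_integral M (\<lambda>\<omega>. Re ((A \<omega> + N \<omega>) * cnj (B \<omega> + K \<omega>))) (c + d)"
  using has_bochner_integral_add[OF has_bochner_integral_add[OF assms(1,2)] has_bochner_integral_add[OF assms(3,4)]]
  by (simp add: algebra_simps)

end

text \<open>The logarithm of the density ratio is affine in the exponents, so its expectation
  depends only on the constants and on the means of the three exponents.\<close>

lemma (in information_space) mutual_information_exp_densities:
  fixes Qx :: "'b \<Rightarrow> real" and Qy :: "'c \<Rightarrow> real" and Qxy :: "'b \<times> 'c \<Rightarrow> real"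
  assumes S: "sigma_finite_measure S" and T: "sigma_finite_measure T"
    and X: "distributed M S X (\<lambda>x. ennreal (Cx * exp (- Qx x)))"
    and Y: "distributed M T Y (\<lambda>y. ennreal (Cy * exp (- Qy y)))"
    and XY: "distributed M (S \<Otimes>\<^sub>M T) (\<lambda>\<omega>. (X \<omega>, Y \<omega>)) (\<lambda>p. ennreal (Cxy * exp (- Qxy p)))"
    and C: "0 < Cx" "0 < Cy" "0 < Cxy"
    and [measurable]: "Qx \<in> borel_measurable S" "Qy \<in> borel_measurable T" "Qxy \<in> borel_measurable (S \<Otimes>\<^sub>M T)"
    and Q: "has_bochner_integral M (\<lambda>\<omega>. Qx (X \<omega>)) ex" "has_bochner_integral M (\<lambda>\<omega>. Qy (Y \<omega>)) ey"
      "has_bochner_integral M (\<lambda>\<omega>. Qxy (X \<omega>, Y \<omega>)) exy"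
  shows "mutual_information b S T X Y = log b (Cxy / (Cx * Cy)) + (ex + ey - exy) / ln b"
proof -
  let ?g = "\<lambda>p. log b (Cxy / (Cx * Cy)) + (Qx (fst p) + Qy (snd p) - Qxy p) / ln b"
  have log_eq: "log b (Cxy * exp (- Qxy p) / (Cx * exp (- Qx (fst p)) * (Cy * exp (- Qy (snd p))))) = ?g p" for p
  proof -
    have "Cxy * exp (- Qxy p) / (Cx * exp (- Qx (fst p)) * (Cy * exp (- Qy (snd p)))) =
      Cxy / (Cx * Cy) * exp (Qx (fst p) + Qy (snd p) - Qxy p)"
      by (simp add: exp_diff exp_add exp_minus field_simps)
    then show ?thesis
      using C by (simp only: log_mult_pos divide_pos_pos mult_pos_pos exp_gt_zero) (simp add: log_def)
  qed
  have "mutual_information b S T X Y = integral\<^sup>L (S \<Otimes>\<^sub>M T) (\<lambda>p. Cxy * exp (- Qxy p) * log b (Cxy * exp (- Qxy p) / (Cx * exp (- Qx (fst p)) * (Cy * exp (- Qy (snd p))))))"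
    using C by (intro mutual_information_distr[OF S T X _ Y _ XY]) auto
  also have "\<dots> = expectation (\<lambda>\<omega>. ?g (X \<omega>, Y \<omega>))"
    unfolding log_eq using C by (intro distributed_integral[OF XY]) auto
  also have "\<dots> = log b (Cxy / (Cx * Cy)) + (ex + ey - exy) / ln b"
    using Q by (simp add: has_bochner_integral_iff prob_space)
  finally show ?thesis .
qed

text \<open>The reference measures matter only through their \<sigma>-algebras. This reconciles the
  Borel spaces in the rate with the Lebesgue measures that carry the densities.\<close>

lemma (in prob_space) mutual_information_cong_sets:
  assumes "sets S = sets S'" "sets T = sets T'"
  shows "mutual_information b S T X Y = mutual_information b S' T' X Y"
proof -
  have "distr M S X = distr M S' X" "distr M T Y = distr M T' Y"
    "distr M (S \<Otimes>\<^sub>M T) (\<lambda>x. (X x, Y x)) = distr M (S' \<Otimes>\<^sub>M T') (\<lambda>x. (X x, Y x))"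
    using assms by (auto intro!: distr_cong sets_pair_measure_cong)
  then show ?thesis by (simp add: mutual_information_def)
qed

subsection \<open>Independence and second moments of the observations\<close>

context overlapping_beam
begin

lemma gains_measurable [measurable]: "random_variable borel h1" "random_variable borel h2"
  using gains_normal by (auto simp: jointly_complex_normal_def)

text \<open>Measurability is hidden in the independence assumption: independent families consist of
  events, and these families are the preimage \<sigma>-algebras of the noises.\<close>

lemma noises_measurable [measurable]:
  "random_variable borel n1_DL" "random_variable borel n1_UL" "random_variable borel n2_DL"
proof -
  let ?F = "(!) [sets (vimage_algebra (space M) (\<lambda>\<omega>. (h1 \<omega>, h2 \<omega>)) borel),
               sets (vimage_algebra (space M) n1_DL borel),
               sets (vimage_algebra (space M) n1_UL borel),
               sets (vimage_algebra (space M) n2_DL borel)]"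
  have "?F i \<subseteq> events" if "i < 4" for i
    using independent that by (auto simp: indep_sets_def)
  from this[of 1] this[of 2] this[of 3]
  have "sets (vimage_algebra (space M) n1_DL borel) \<subseteq> events"
    "sets (vimage_algebra (space M) n1_UL borel) \<subseteq> events"
    "sets (vimage_algebra (space M) n2_DL borel) \<subseteq> events"
    by (simp_all add: numeral_2_eq_2 numeral_3_eq_3)
  then show "random_variable borel n1_DL" "random_variable borel n1_UL" "random_variable borel n2_DL"
    by (auto intro!: measurableI dest: in_vimage_algebra[of _ borel _ "space M"] simp: subset_eq)
qed

text \<open>The noises are padded with a zero component to give all four variables the same type.\<close>

lemma indep_vars_padded:
  "indep_vars (\<lambda>_. borel)
     (\<lambda>i \<omega>. [(h1 \<omega>, h2 \<omega>), (n1_DL \<omega>, 0), (n1_UL \<omega>, 0), (n2_DL \<omega>, 0)] ! i) {..<4}"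
  (is "indep_vars _ ?X _")
  unfolding indep_vars_def2
proof
  have four: "i = 0 \<or> i = 1 \<or> i = 2 \<or> i = 3" if "i \<in> {..<4}" for i :: nat
    using that by auto
  show "\<forall>i\<in>{..<4}. random_variable borel (?X i)"
  proof
    fix i :: nat assume "i \<in> {..<4}"
    from four[OF this] show "random_variable borel (?X i)"
      by (elim disjE) (simp_all add: numeral_2_eq_2 numeral_3_eq_3)
  qed
  have pad: "(\<lambda>\<omega>. (f \<omega>, 0 :: complex)) -` A \<inter> space M \<in> sets (vimage_algebra (space M) f borel)"
    if A: "A \<in> sets borel" for f :: "'a \<Rightarrow> complex" and A
  proof -
    have "(\<lambda>z :: complex. (z, 0 :: complex)) -` A \<inter> space borel \<in> sets borel"
      by (rule measurable_sets[OF _ A]) measurable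
    from in_vimage_algebra[OF this, of f "space M"] show ?thesis
      by (simp add: vimage_def)
  qed
  show "indep_sets (\<lambda>i. {?X i -` A \<inter> space M |A. A \<in> sets borel}) {..<4}"
  proof (rule indep_sets_mono_sets[OF independent])
    fix i :: nat assume "i \<in> {..<4}"
    from four[OF this]
    show "{?X i -` A \<inter> space M |A. A \<in> sets borel} \<subseteq>
      [sets (vimage_algebra (space M) (\<lambda>\<omega>. (h1 \<omega>, h2 \<omega>)) borel),
       sets (vimage_algebra (space M) n1_DL borel),
       sets (vimage_algebra (space M) n1_UL borel),
       sets (vimage_algebra (space M) n2_DL borel)] ! i"
      by (elim disjE) (auto simp: numeral_2_eq_2 numeral_3_eq_3 intro!: pad in_vimage_algebra)
  qed
qed

lemma measurable_fst_component:
  "i \<in> I \<Longrightarrow> (\<lambda>r. fst (r i)) \<in> borel_measurable (PiM I (\<lambda>_. borel :: (complex \<times> complex) measure))"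
  by (rule measurable_compose[OF measurable_component_singleton])
    (auto intro!: borel_measurable_continuous_onI continuous_intros)

text \<open>Independence of blocks, for the index sets {0} and {1, 2, 3}; \<open>fst\<close> strips
  the padding. The common codomain of \<open>f\<close> and \<open>g\<close> is dictated by
  \<open>indep_var\<close>.\<close>

lemma indep_gains_noises:
  fixes f :: "complex \<times> complex \<Rightarrow> 'e::topological_space" and g :: "complex \<times> complex \<times> complex \<Rightarrow> 'e"
  assumes [measurable]: "f \<in> borel_measurable borel" "g \<in> borel_measurable borel"
  shows "indep_var borel (\<lambda>\<omega>. f (h1 \<omega>, h2 \<omega>)) borel (\<lambda>\<omega>. g (n1_DL \<omega>, n1_UL \<omega>, n2_DL \<omega>))"
proof -
  have "indep_var borel ((\<lambda>r. f (r 0)) \<circ> (\<lambda>\<omega>. \<lambda>i\<in>{0}. [(h1 \<omega>, h2 \<omega>), (n1_DL \<omega>, 0), (n1_UL \<omega>, 0), (n2_DL \<omega>, 0)] ! i))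
    borel ((\<lambda>r. g (fst (r 1), fst (r 2), fst (r 3))) \<circ> (\<lambda>\<omega>. \<lambda>i\<in>{1,2,3}. [(h1 \<omega>, h2 \<omega>), (n1_DL \<omega>, 0), (n1_UL \<omega>, 0), (n2_DL \<omega>, 0)] ! i))"
    by (rule indep_var_compose[OF indep_var_restrict[OF indep_vars_padded]])
      (auto intro!: measurable_compose[OF _ assms(2)] borel_measurable_Pair measurable_fst_component)
  then show ?thesis
    by (simp add: comp_def numeral_2_eq_2 numeral_3_eq_3)
qed

text \<open>In the first statement \<open>n1_DL\<close> keeps its padding, so that both sides are
  pairs of complex numbers.\<close>

lemma indep_noises:
  "indep_var borel (\<lambda>\<omega>. (n1_DL \<omega>, 0)) borel (\<lambda>\<omega>. (n1_UL \<omega>, n2_DL \<omega>))"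
  "indep_var borel n1_DL borel n1_UL" "indep_var borel n1_DL borel n2_DL" "indep_var borel n1_UL borel n2_DL"
proof -
  let ?X = "\<lambda>i \<omega>. [(h1 \<omega>, h2 \<omega>), (n1_DL \<omega>, 0), (n1_UL \<omega>, 0), (n2_DL \<omega>, 0)] ! i"
  have *: "indep_var borel (f \<circ> (\<lambda>\<omega>. \<lambda>i\<in>I. ?X i \<omega>)) borel (g \<circ> (\<lambda>\<omega>. \<lambda>i\<in>J. ?X i \<omega>))"
    if "f \<in> borel_measurable (PiM I (\<lambda>_. borel))" "g \<in> borel_measurable (PiM J (\<lambda>_. borel))"
      "I \<inter> J = {}" "I \<subseteq> {..<4}" "J \<subseteq> {..<4}"
    for f g :: "(nat \<Rightarrow> complex \<times> complex) \<Rightarrow> 'e::topological_space" and I J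
    using that by (intro indep_var_compose[OF indep_var_restrict[OF indep_vars_padded]])
  note s = comp_def numeral_2_eq_2 numeral_3_eq_3
  have "indep_var borel ((\<lambda>r. r 1) \<circ> (\<lambda>\<omega>. \<lambda>i\<in>{1}. ?X i \<omega>)) borel ((\<lambda>r. (fst (r 2), fst (r 3))) \<circ> (\<lambda>\<omega>. \<lambda>i\<in>{2,3}. ?X i \<omega>))"
    by (rule *) (auto intro!: borel_measurable_Pair measurable_fst_component)
  then show "indep_var borel (\<lambda>\<omega>. (n1_DL \<omega>, 0)) borel (\<lambda>\<omega>. (n1_UL \<omega>, n2_DL \<omega>))"
    by (simp add: s)
  have "indep_var borel ((\<lambda>r. fst (r i)) \<circ> (\<lambda>\<omega>. \<lambda>i\<in>{i}. ?X i \<omega>)) borel ((\<lambda>r. fst (r j)) \<circ> (\<lambda>\<omega>. \<lambda>i\<in>{j}. ?X i \<omega>))"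
    if "i < 4" "j < 4" "i \<noteq> j" for i j
    using that by (intro *) (auto intro!: measurable_fst_component)
  from this[of 1 2] this[of 1 3] this[of 2 3]
  show "indep_var borel n1_DL borel n1_UL" "indep_var borel n1_DL borel n2_DL" "indep_var borel n1_UL borel n2_DL"
    by (simp_all add: s)
qed

lemma noise_moments:
  assumes [measurable]: "random_variable borel n" and n: "distr M borel n = complex_normal (\<sigma>\<^sup>2)"
  shows "distributed M lborel n (\<lambda>z. ennreal (exp (- (norm z)\<^sup>2 / \<sigma>\<^sup>2) / (pi * \<sigma>\<^sup>2)))"
    and "integrable M n" "expectation n = 0"
    and "has_bochner_integral M (\<lambda>\<omega>. Re (n \<omega> * cnj (n \<omega>))) (\<sigma>\<^sup>2)"
proof -
  have s: "0 < \<sigma>\<^sup>2" using sigma_pos by simp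
  have "distr M lborel n = distr M borel n"
    by (rule distr_cong) auto
  then show "distributed M lborel n (\<lambda>z. ennreal (exp (- (norm z)\<^sup>2 / \<sigma>\<^sup>2) / (pi * \<sigma>\<^sup>2)))"
    using n s unfolding distributed_def complex_normal_def by auto
  have sq: "has_bochner_integral M (\<lambda>\<omega>. (norm (n \<omega>))\<^sup>2) (\<sigma>\<^sup>2)"
    using s by (intro has_bochner_integral_norm_square_if_complex_normal[OF _ n]) auto
  then show "has_bochner_integral M (\<lambda>\<omega>. Re (n \<omega> * cnj (n \<omega>))) (\<sigma>\<^sup>2)"
    by (simp add: complex_norm_square[symmetric])
  show "integrable M n"
    using sq by (intro square_integrable_cmod_imp_integrable) (auto simp: has_bochner_integral_iff)
  have "expectation n = integral\<^sup>L (distr M borel n) (\<lambda>z. z)"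
    by (simp add: integral_distr)
  then show "expectation n = 0"
    unfolding n integral_complex_normal_ident[OF s] .
qed

lemmas n1_DL_moments = noise_moments[OF noises_measurable(1) n1_DL_normal]
lemmas n1_UL_moments = noise_moments[OF noises_measurable(2) n1_UL_normal]
lemmas n2_DL_moments = noise_moments[OF noises_measurable(3) n2_DL_normal]

lemma gains_square_integrable:
  "integrable M (\<lambda>\<omega>. (norm (h1 \<omega>))\<^sup>2)" "integrable M (\<lambda>\<omega>. (norm (h2 \<omega>))\<^sup>2)"
  using jointly_complex_normal_lincomb(1)[OF gains_normal, of 1 0]
    jointly_complex_normal_lincomb(1)[OF gains_normal, of 0 1] by auto

lemma gain_moments:
  "has_bochner_integral M (\<lambda>\<omega>. Re (h1 \<omega> * cnj (h1 \<omega>))) 1"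
  "has_bochner_integral M (\<lambda>\<omega>. Re (h2 \<omega> * cnj (h2 \<omega>))) 1"
  "has_bochner_integral M (\<lambda>\<omega>. Re (h1 \<omega> * cnj (h2 \<omega>))) \<rho>"
proof -
  show "has_bochner_integral M (\<lambda>\<omega>. Re (h1 \<omega> * cnj (h1 \<omega>))) 1" "has_bochner_integral M (\<lambda>\<omega>. Re (h2 \<omega> * cnj (h2 \<omega>))) 1"
    using gains_square_integrable gain1_power gain2_power
    by (simp_all add: complex_norm_square[symmetric] has_bochner_integral_iff)
  have "has_bochner_integral M (\<lambda>\<omega>. h1 \<omega> * cnj (h2 \<omega>)) (of_real \<rho>)"
    using integrable_mult_cnj[OF _ _ gains_square_integrable] gains_correlation
    by (simp add: has_bochner_integral_iff)
  from has_bochner_integral_bounded_linear[OF bounded_linear_Re this]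
  show "has_bochner_integral M (\<lambda>\<omega>. Re (h1 \<omega> * cnj (h2 \<omega>))) \<rho>" by simp
qed

lemma gain_noise_moments:
  assumes "h \<in> {h1, h2}" "n \<in> {n1_DL, n1_UL, n2_DL}"
  shows "has_bochner_integral M (\<lambda>\<omega>. Re (h \<omega> * cnj (n \<omega>))) 0"
proof (rule indep_var_mult_cnj)
  have [measurable]: "fst \<in> borel_measurable (borel :: (complex \<times> complex) measure)" "snd \<in> borel_measurable (borel :: (complex \<times> complex) measure)"
    "(\<lambda>p. fst (snd p)) \<in> borel_measurable (borel :: (complex \<times> complex \<times> complex) measure)" "(\<lambda>p. snd (snd p)) \<in> borel_measurable (borel :: (complex \<times> complex \<times> complex) measure)"
    "fst \<in> borel_measurable (borel :: (complex \<times> complex \<times> complex) measure)"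
    by (auto intro!: borel_measurable_continuous_onI continuous_intros)
  have *: "indep_var borel (\<lambda>\<omega>. f (h1 \<omega>, h2 \<omega>)) borel (\<lambda>\<omega>. g (n1_DL \<omega>, n1_UL \<omega>, n2_DL \<omega>))"
    if "f \<in> {fst, snd}" "g \<in> {fst, (\<lambda>p. fst (snd p)), (\<lambda>p. snd (snd p))}" for f :: "complex \<times> complex \<Rightarrow> complex" and g
    using that by (intro indep_gains_noises) auto
  show "indep_var borel h borel n"
    using assms *[of fst fst] *[of fst "\<lambda>p. fst (snd p)"] *[of fst "\<lambda>p. snd (snd p)"]
      *[of snd fst] *[of snd "\<lambda>p. fst (snd p)"] *[of snd "\<lambda>p. snd (snd p)"] by auto
  show "integrable M h"
    using assms gains_square_integrable by (auto intro!: square_integrable_cmod_imp_integrable)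
  show "integrable M n" "expectation n = 0"
    using assms n1_DL_moments n1_UL_moments n2_DL_moments by auto
qed

lemma noise_cross_moments:
  "has_bochner_integral M (\<lambda>\<omega>. Re (n1_DL \<omega> * cnj (n1_UL \<omega>))) 0"
  "has_bochner_integral M (\<lambda>\<omega>. Re (n1_DL \<omega> * cnj (n2_DL \<omega>))) 0"
  "has_bochner_integral M (\<lambda>\<omega>. Re (n1_UL \<omega> * cnj (n2_DL \<omega>))) 0"
  by (rule indep_var_mult_cnj[OF indep_noises(2) n1_DL_moments(2) n1_UL_moments(2,3)]
      indep_var_mult_cnj[OF indep_noises(3) n1_DL_moments(2) n2_DL_moments(2,3)]
      indep_var_mult_cnj[OF indep_noises(4) n1_UL_moments(2) n2_DL_moments(2,3)])+

text \<open>These are the entries of the covariance matrix of (x, y, w). Noise contributes only on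
  the diagonal; the entry 1 arises because \<open>x\<close> and \<open>y\<close> share the gain
  \<open>h1\<close>.\<close>

lemma observation_moments:
  "has_bochner_integral M (\<lambda>\<omega>. Re (x \<omega> * cnj (x \<omega>))) (1 + \<sigma>\<^sup>2)"
  "has_bochner_integral M (\<lambda>\<omega>. Re (y \<omega> * cnj (y \<omega>))) (1 + \<sigma>\<^sup>2)"
  "has_bochner_integral M (\<lambda>\<omega>. Re (w \<omega> * cnj (w \<omega>))) (1 + \<sigma>\<^sup>2)"
  "has_bochner_integral M (\<lambda>\<omega>. Re (x \<omega> * cnj (y \<omega>))) 1"
  "has_bochner_integral M (\<lambda>\<omega>. Re (x \<omega> * cnj (w \<omega>))) \<rho>"
  "has_bochner_integral M (\<lambda>\<omega>. Re (y \<omega> * cnj (w \<omega>))) \<rho>"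
  unfolding x_def y_def w_def
  using has_bochner_integral_Re_mult_cnj_add[OF gain_moments(1) gain_noise_moments gain_noise_moments n1_DL_moments(4)]
    has_bochner_integral_Re_mult_cnj_add[OF gain_moments(1) gain_noise_moments gain_noise_moments n1_UL_moments(4)]
    has_bochner_integral_Re_mult_cnj_add[OF gain_moments(2) gain_noise_moments gain_noise_moments n2_DL_moments(4)]
    has_bochner_integral_Re_mult_cnj_add[OF gain_moments(1) gain_noise_moments gain_noise_moments noise_cross_moments(1)]
    has_bochner_integral_Re_mult_cnj_add[OF gain_moments(3) gain_noise_moments gain_noise_moments noise_cross_moments(2)]
    has_bochner_integral_Re_mult_cnj_add[OF gain_moments(3) gain_noise_moments gain_noise_moments noise_cross_moments(3)]
  by simp_all

end

subsection \<open>Densities of the observations and the secret key rate\<close>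

lemma (in prob_space) distributed_add_indep_real:
  fixes H N :: "'a \<Rightarrow> 'e::euclidean_space"
  assumes indep: "indep_var borel H borel N" and N: "distributed M lborel N (\<lambda>z. ennreal (f z))"
    and f: "\<And>z. 0 \<le> f z" and g: "\<And>z. expectation (\<lambda>\<omega>. f (z - H \<omega>)) = g z" "\<And>z. 0 < g z"
  shows "distributed M lborel (\<lambda>\<omega>. H \<omega> + N \<omega>) (\<lambda>z. ennreal (g z))"
proof -
  have "(\<integral>\<^sup>+\<omega>. ennreal (f (z - H \<omega>)) \<partial>M) = ennreal (g z)" for z
  proof -
    \<comment> \<open>A non-integrable function has Bochner integral 0 by convention, so the
      positive value \<open>g z\<close> already implies integrability.\<close>
    have "integrable M (\<lambda>\<omega>. f (z - H \<omega>))"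
      using g[of z] not_integrable_integral_eq by fastforce
    then show ?thesis
      using f g by (simp add: nn_integral_eq_integral)
  qed
  then show ?thesis
    using distributed_add_indep[OF indep N] by simp
qed

text \<open>This is the Hermitian form of the inverse of the covariance matrix with diagonal 1 + a,
  1 + b and off-diagonal entries \<rho>: unit gains with added noise of variances \<open>a\<close>
  and \<open>b\<close>.\<close>

definition gauss_form :: "real \<Rightarrow> real \<Rightarrow> real \<Rightarrow> complex \<Rightarrow> complex \<Rightarrow> real" where
  "gauss_form \<rho> a b u v =
     ((1 + b) * (norm u)\<^sup>2 + (1 + a) * (norm v)\<^sup>2 - 2 * \<rho> * Re (u * cnj v)) / ((1 + a) * (1 + b) - \<rho>\<^sup>2)"

lemma borel_measurable_gauss_form [measurable (raw)]:
  assumes [measurable]: "f \<in> borel_measurable M" "g \<in> borel_measurable M"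
  shows "(\<lambda>x. gauss_form \<rho> a b (f x) (g x)) \<in> borel_measurable M"
  unfolding gauss_form_def by measurable

lemma norm_square_eq_Re: "(norm z)\<^sup>2 = Re (z * cnj z)"
  unfolding cmod_power2 by (simp add: power2_eq_square)

text \<open>The gains alone contribute 1 - \<rho>^2, which vanishes for full correlation; the noise
  adds a + b + a b > 0.\<close>

lemma covariance_det_pos:
  fixes a b \<rho> :: real
  assumes "0 < a" "0 < b" "\<rho>\<^sup>2 \<le> 1"
  shows "0 < (1 + a) * (1 + b) - \<rho>\<^sup>2"
proof -
  have "(1 + a) * (1 + b) = 1 + a + b + a * b" by (simp add: algebra_simps)
  then show ?thesis using assms mult_pos_pos[OF assms(1,2)] by linarith
qed

text \<open>The mean is the trace of the inverse covariance times the covariance, that is, of the 2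
  x 2 identity matrix.\<close>

lemma has_bochner_integral_gauss_form:
  assumes U: "has_bochner_integral M (\<lambda>\<omega>. Re (U \<omega> * cnj (U \<omega>))) (1 + a)"
    and V: "has_bochner_integral M (\<lambda>\<omega>. Re (V \<omega> * cnj (V \<omega>))) (1 + b)"
    and UV: "has_bochner_integral M (\<lambda>\<omega>. Re (U \<omega> * cnj (V \<omega>))) \<rho>"
    and D: "0 < (1 + a) * (1 + b) - \<rho>\<^sup>2"
  shows "has_bochner_integral M (\<lambda>\<omega>. gauss_form \<rho> a b (U \<omega>) (V \<omega>)) 2"
proof -
  have "((1 + b) * (1 + a) + (1 + a) * (1 + b) - 2 * \<rho> * \<rho>) / ((1 + a) * (1 + b) - \<rho>\<^sup>2) = 2"
    using D by (simp add: divide_eq_eq power2_eq_square algebra_simps)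
  moreover have "has_bochner_integral M (\<lambda>\<omega>. gauss_form \<rho> a b (U \<omega>) (V \<omega>))
     (((1 + b) * (1 + a) + (1 + a) * (1 + b) - 2 * \<rho> * \<rho>) / ((1 + a) * (1 + b) - \<rho>\<^sup>2))"
    unfolding gauss_form_def norm_square_eq_Re
    by (intro has_bochner_integral_divide_zero has_bochner_integral_diff has_bochner_integral_add
        has_bochner_integral_mult_right U V UV)
  ultimately show ?thesis by simp
qed

context overlapping_beam
begin

lemma expectation_exp_gauss_form:
  assumes "0 < a" "0 < b" "\<rho>\<^sup>2 \<le> 1"
  shows "expectation (\<lambda>\<omega>. exp (- ((norm (u - h1 \<omega>))\<^sup>2 / a) - (norm (v - h2 \<omega>))\<^sup>2 / b)) =
    a * b / ((1 + a) * (1 + b) - \<rho>\<^sup>2) * exp (- gauss_form \<rho> a b u v)"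
  unfolding gauss_form_def
  by (rule expectation_exp_quadratic_pair[OF gains_measurable
      jointly_complex_normal_char[OF gains_normal gain1_power gain2_power gains_correlation]
      assms(1,2) covariance_det_pos[OF assms]])

text \<open>Presenting \<open>h\<close> as a linear combination gives access to its law; the
  coefficients (1, 0) and (0, 1) select the two gains.\<close>

lemma single_density:
  assumes h: "h = (\<lambda>\<omega>. a * h1 \<omega> + b * h2 \<omega>)" "expectation (\<lambda>\<omega>. (norm (h \<omega>))\<^sup>2) = 1"
    and indep: "indep_var borel h borel n"
    and n: "distributed M lborel n (\<lambda>z. ennreal (exp (- (norm z)\<^sup>2 / \<sigma>\<^sup>2) / (pi * \<sigma>\<^sup>2)))"
  shows "distributed M lborel (\<lambda>\<omega>. h \<omega> + n \<omega>) (\<lambda>z. ennreal (1 / (pi * (1 + \<sigma>\<^sup>2)) * exp (- ((norm z)\<^sup>2 / (1 + \<sigma>\<^sup>2)))))"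
proof (rule distributed_add_indep_real[OF indep n])
  have s: "0 < \<sigma>\<^sup>2" using sigma_pos by simp
  have [measurable]: "random_variable borel h" unfolding h(1) by measurable
  have law: "distr M borel h = complex_normal 1"
    using jointly_complex_normal_lincomb(2)[OF gains_normal, of a b] h(2) unfolding h(1) by simp
  fix z
  have "expectation (\<lambda>\<omega>. exp (- ((norm (z - h \<omega>))\<^sup>2 / \<sigma>\<^sup>2))) = integral\<^sup>L (distr M borel h) (\<lambda>t. exp (- ((norm (z - t))\<^sup>2 / \<sigma>\<^sup>2)))"
    by (subst integral_distr) auto
  also have "\<dots> = \<sigma>\<^sup>2 / (1 + \<sigma>\<^sup>2) * exp (- ((norm z)\<^sup>2 / (1 + \<sigma>\<^sup>2)))"
    unfolding law by (rule has_bochner_integral_integral_eq[OF has_bochner_integral_complex_normal_exp_quadratic[OF s]])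
  finally show "expectation (\<lambda>\<omega>. exp (- (norm (z - h \<omega>))\<^sup>2 / \<sigma>\<^sup>2) / (pi * \<sigma>\<^sup>2)) = 1 / (pi * (1 + \<sigma>\<^sup>2)) * exp (- ((norm z)\<^sup>2 / (1 + \<sigma>\<^sup>2)))"
    using s by simp
  show "0 < 1 / (pi * (1 + \<sigma>\<^sup>2)) * exp (- ((norm z)\<^sup>2 / (1 + \<sigma>\<^sup>2)))"
    using s by (simp add: add_pos_pos)
qed simp

text \<open>The noise \<open>n\<close> is left open so that the downlink and the uplink noise of the
  first terminal yield the densities of (x, w) and (y, w) alike.\<close>

lemma pair_density:
  assumes r: "\<rho>\<^sup>2 \<le> 1"
    and indep: "indep_var borel (\<lambda>\<omega>. (h1 \<omega>, h2 \<omega>)) borel (\<lambda>\<omega>. (n \<omega>, n2_DL \<omega>))" "indep_var borel n borel n2_DL"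
    and n: "distributed M lborel n (\<lambda>z. ennreal (exp (- (norm z)\<^sup>2 / \<sigma>\<^sup>2) / (pi * \<sigma>\<^sup>2)))"
  shows "distributed M lborel (\<lambda>\<omega>. (h1 \<omega> + n \<omega>, h2 \<omega> + n2_DL \<omega>))
    (\<lambda>p. ennreal (1 / (pi\<^sup>2 * ((1 + \<sigma>\<^sup>2)\<^sup>2 - \<rho>\<^sup>2)) * exp (- gauss_form \<rho> (\<sigma>\<^sup>2) (\<sigma>\<^sup>2) (fst p) (snd p))))"
proof -
  have s: "0 < \<sigma>\<^sup>2" using sigma_pos by simp
  have D: "0 < (1 + \<sigma>\<^sup>2)\<^sup>2 - \<rho>\<^sup>2"
    using covariance_det_pos[OF s s r] by (simp add: power2_eq_square[of "1 + _"])
  let ?f = "\<lambda>p :: complex \<times> complex. 1 / (pi * \<sigma>\<^sup>2)\<^sup>2 * exp (- ((norm (fst p))\<^sup>2 / \<sigma>\<^sup>2) - (norm (snd p))\<^sup>2 / \<sigma>\<^sup>2)"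
  have "distributed M lborel (\<lambda>\<omega>. (n \<omega>, n2_DL \<omega>))
     (\<lambda>(z, t). ennreal (exp (- (norm z)\<^sup>2 / \<sigma>\<^sup>2) / (pi * \<sigma>\<^sup>2)) * ennreal (exp (- (norm t)\<^sup>2 / \<sigma>\<^sup>2) / (pi * \<sigma>\<^sup>2)))"
    by (rule distributed_joint_indep_lborel[OF indep(2) _ _ n n2_DL_moments(1)]) auto
  also have "(\<lambda>(z, t). ennreal (exp (- (norm z)\<^sup>2 / \<sigma>\<^sup>2) / (pi * \<sigma>\<^sup>2)) * ennreal (exp (- (norm t)\<^sup>2 / \<sigma>\<^sup>2) / (pi * \<sigma>\<^sup>2))) =
     (\<lambda>p. ennreal (?f p))"
  proof -
    have "exp (- (norm z)\<^sup>2 / \<sigma>\<^sup>2) / (pi * \<sigma>\<^sup>2) * (exp (- (norm t)\<^sup>2 / \<sigma>\<^sup>2) / (pi * \<sigma>\<^sup>2)) = ?f (z, t)" for z t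
      by (simp add: power2_eq_square[of "pi * _"] flip: exp_add)
    then show ?thesis
      using s by (auto simp: fun_eq_iff ennreal_mult[symmetric])
  qed
  finally have N: "distributed M lborel (\<lambda>\<omega>. (n \<omega>, n2_DL \<omega>)) (\<lambda>p. ennreal (?f p))" .
  have "distributed M lborel (\<lambda>\<omega>. (h1 \<omega>, h2 \<omega>) + (n \<omega>, n2_DL \<omega>))
    (\<lambda>p. ennreal (1 / (pi\<^sup>2 * ((1 + \<sigma>\<^sup>2)\<^sup>2 - \<rho>\<^sup>2)) * exp (- gauss_form \<rho> (\<sigma>\<^sup>2) (\<sigma>\<^sup>2) (fst p) (snd p))))"
  proof (rule distributed_add_indep_real[OF indep(1) N])
    fix p :: "complex \<times> complex"
    have "1 / (pi * \<sigma>\<^sup>2)\<^sup>2 * (\<sigma>\<^sup>2 * \<sigma>\<^sup>2 / ((1 + \<sigma>\<^sup>2) * (1 + \<sigma>\<^sup>2) - \<rho>\<^sup>2)) = 1 / (pi\<^sup>2 * ((1 + \<sigma>\<^sup>2)\<^sup>2 - \<rho>\<^sup>2))"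
      using sigma_pos by (simp add: power2_eq_square)
    then show "expectation (\<lambda>\<omega>. ?f (p - (h1 \<omega>, h2 \<omega>))) = 1 / (pi\<^sup>2 * ((1 + \<sigma>\<^sup>2)\<^sup>2 - \<rho>\<^sup>2)) * exp (- gauss_form \<rho> (\<sigma>\<^sup>2) (\<sigma>\<^sup>2) (fst p) (snd p))"
      using expectation_exp_gauss_form[OF s s r, of "fst p" "snd p"] by (simp only: fst_diff snd_diff fst_conv snd_conv integral_mult_right_zero mult.assoc[symmetric])
    show "0 < 1 / (pi\<^sup>2 * ((1 + \<sigma>\<^sup>2)\<^sup>2 - \<rho>\<^sup>2)) * exp (- gauss_form \<rho> (\<sigma>\<^sup>2) (\<sigma>\<^sup>2) (fst p) (snd p))"
      using D by simp
  qed simp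
  then show ?thesis by simp
qed

text \<open>The factor in x - y does not involve the gains and leaves the expectation. What remains
  is the two-bump average, in which averaging two noises has halved the first width.\<close>

lemma triple_density:
  assumes r: "\<rho>\<^sup>2 \<le> 1"
  shows "distributed M lborel (\<lambda>\<omega>. (x \<omega>, y \<omega>, w \<omega>))
    (\<lambda>p. ennreal (1 / (pi ^ 3 * (2 * \<sigma>\<^sup>2 * ((1 + \<sigma>\<^sup>2 / 2) * (1 + \<sigma>\<^sup>2) - \<rho>\<^sup>2))) *
       exp (- ((norm (fst p - fst (snd p)))\<^sup>2 / (2 * \<sigma>\<^sup>2) + gauss_form \<rho> (\<sigma>\<^sup>2 / 2) (\<sigma>\<^sup>2) ((fst p + fst (snd p)) / 2) (snd (snd p))))))"
    (is "distributed M lborel _ (\<lambda>p. ennreal (?g p))")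
proof -
  have s: "0 < \<sigma>\<^sup>2" "0 < \<sigma>\<^sup>2 / 2" using sigma_pos by auto
  have D: "0 < (1 + \<sigma>\<^sup>2 / 2) * (1 + \<sigma>\<^sup>2) - \<rho>\<^sup>2"
    by (rule covariance_det_pos[OF s(2,1) r])
  let ?e = "\<lambda>z. exp (- (norm z)\<^sup>2 / \<sigma>\<^sup>2) / (pi * \<sigma>\<^sup>2)"
  let ?f = "\<lambda>p :: complex \<times> complex \<times> complex. ?e (fst p) * (?e (fst (snd p)) * ?e (snd (snd p)))"
  have fst: "fst \<in> borel_measurable (borel :: (complex \<times> complex) measure)"
    by (auto intro!: borel_measurable_continuous_onI continuous_intros)
  have id: "(\<lambda>z :: 'c::topological_space. z) \<in> borel_measurable borel" by simp
  note n23 = distributed_joint_indep_lborel[OF indep_noises(4) id id n1_UL_moments(1) n2_DL_moments(1)]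
  have n1: "distributed M lborel (\<lambda>\<omega>. fst (n1_DL \<omega>, 0 :: complex)) (\<lambda>z. ennreal (?e z))"
    using n1_DL_moments(1) by simp
  have "distributed M lborel (\<lambda>\<omega>. (n1_DL \<omega>, n1_UL \<omega>, n2_DL \<omega>)) (\<lambda>(z, t). ennreal (?e z) * (case t of (z, t) \<Rightarrow> ennreal (?e z) * ennreal (?e t)))"
    using distributed_joint_indep_lborel[OF indep_noises(1) fst id n1 n23] by simp
  also have "(\<lambda>(z, t). ennreal (?e z) * (case t of (z, t) \<Rightarrow> ennreal (?e z) * ennreal (?e t))) = (\<lambda>p. ennreal (?f p))"
    using s by (auto simp: fun_eq_iff ennreal_mult[symmetric])
  finally have N: "distributed M lborel (\<lambda>\<omega>. (n1_DL \<omega>, n1_UL \<omega>, n2_DL \<omega>)) (\<lambda>p. ennreal (?f p))" .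
  have indep: "indep_var borel (\<lambda>\<omega>. (h1 \<omega>, h1 \<omega>, h2 \<omega>)) borel (\<lambda>\<omega>. (n1_DL \<omega>, n1_UL \<omega>, n2_DL \<omega>))"
    using indep_gains_noises[of "\<lambda>p. (fst p, fst p, snd p)" "\<lambda>p. p"]
    by (simp add: borel_measurable_continuous_onI continuous_intros)
  have "distributed M lborel (\<lambda>\<omega>. (h1 \<omega>, h1 \<omega>, h2 \<omega>) + (n1_DL \<omega>, n1_UL \<omega>, n2_DL \<omega>)) (\<lambda>p. ennreal (?g p))"
  proof (rule distributed_add_indep_real[OF indep N])
    fix p :: "complex \<times> complex \<times> complex"
    obtain u t v where p: "p = (u, t, v)" by (cases p) auto
    let ?c = "1 / (pi * \<sigma>\<^sup>2) ^ 3 * exp (- ((norm (u - t))\<^sup>2 / (2 * \<sigma>\<^sup>2)))"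
    let ?E = "\<lambda>\<omega>. exp (- ((norm ((u + t) / 2 - h1 \<omega>))\<^sup>2 / (\<sigma>\<^sup>2 / 2)) - (norm (v - h2 \<omega>))\<^sup>2 / \<sigma>\<^sup>2)"
    have "?f (p - (h1 \<omega>, h1 \<omega>, h2 \<omega>)) = ?c * ?E \<omega>" for \<omega>
    proof -
      \<comment> \<open>The parallelogram identity merges the two bumps centred at the same
        gain.\<close>
      have "(norm (u - h))\<^sup>2 + (norm (t - h))\<^sup>2 = (norm (u - t))\<^sup>2 / 2 + 2 * (norm ((u + t) / 2 - h))\<^sup>2" for h
        unfolding cmod_power2 by (simp add: power2_eq_square field_simps)
      then have "- ((norm (u - h1 \<omega>))\<^sup>2 + (norm (t - h1 \<omega>))\<^sup>2) / \<sigma>\<^sup>2 = - ((norm (u - t))\<^sup>2 / 2 + 2 * (norm ((u + t) / 2 - h1 \<omega>))\<^sup>2) / \<sigma>\<^sup>2"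
        by simp
      also have "\<dots> = - ((norm (u - t))\<^sup>2 / (2 * \<sigma>\<^sup>2)) + - ((norm ((u + t) / 2 - h1 \<omega>))\<^sup>2 / (\<sigma>\<^sup>2 / 2))"
        by (simp add: add_divide_distrib diff_divide_distrib)
      finally have "- (norm (u - h1 \<omega>))\<^sup>2 / \<sigma>\<^sup>2 + (- (norm (t - h1 \<omega>))\<^sup>2 / \<sigma>\<^sup>2 + - (norm (v - h2 \<omega>))\<^sup>2 / \<sigma>\<^sup>2) =
        - ((norm (u - t))\<^sup>2 / (2 * \<sigma>\<^sup>2)) + (- ((norm ((u + t) / 2 - h1 \<omega>))\<^sup>2 / (\<sigma>\<^sup>2 / 2)) - (norm (v - h2 \<omega>))\<^sup>2 / \<sigma>\<^sup>2)"
        by (simp add: add_divide_distrib diff_divide_distrib)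
      then have "exp (- (norm (u - h1 \<omega>))\<^sup>2 / \<sigma>\<^sup>2) * (exp (- (norm (t - h1 \<omega>))\<^sup>2 / \<sigma>\<^sup>2) * exp (- (norm (v - h2 \<omega>))\<^sup>2 / \<sigma>\<^sup>2)) =
        exp (- ((norm (u - t))\<^sup>2 / (2 * \<sigma>\<^sup>2))) * ?E \<omega>"
        by (simp only: exp_add[symmetric])
      moreover have "p1 / c * (p2 / c * (p3 / c)) = 1 / c ^ 3 * (p1 * (p2 * p3))" for p1 p2 p3 c :: real
        by (simp add: power3_eq_cube)
      ultimately show ?thesis
        by (simp only: p fst_diff snd_diff fst_conv snd_conv mult.assoc)
    qed
    then have "expectation (\<lambda>\<omega>. ?f (p - (h1 \<omega>, h1 \<omega>, h2 \<omega>))) = ?c * expectation ?E"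
      by simp
    also have "\<dots> = ?c * (\<sigma>\<^sup>2 / 2 * \<sigma>\<^sup>2 / ((1 + \<sigma>\<^sup>2 / 2) * (1 + \<sigma>\<^sup>2) - \<rho>\<^sup>2) * exp (- gauss_form \<rho> (\<sigma>\<^sup>2 / 2) (\<sigma>\<^sup>2) ((u + t) / 2) v))"
      by (simp only: expectation_exp_gauss_form[OF s(2,1) r])
    also have "\<dots> = 1 / (pi * \<sigma>\<^sup>2) ^ 3 * (\<sigma>\<^sup>2 / 2 * \<sigma>\<^sup>2 / ((1 + \<sigma>\<^sup>2 / 2) * (1 + \<sigma>\<^sup>2) - \<rho>\<^sup>2)) *
        exp (- ((norm (u - t))\<^sup>2 / (2 * \<sigma>\<^sup>2) + gauss_form \<rho> (\<sigma>\<^sup>2 / 2) (\<sigma>\<^sup>2) ((u + t) / 2) v))"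
      by (simp only: minus_add_distrib exp_add mult_ac)
    \<comment> \<open>Three noise normalisations meet the widths \<open>\<sigma>\<^sup>2 / 2\<close>
      and \<open>\<sigma>\<^sup>2\<close> of the two bumps.\<close>
    also have "1 / (pi * \<sigma>\<^sup>2) ^ 3 * (\<sigma>\<^sup>2 / 2 * \<sigma>\<^sup>2 / ((1 + \<sigma>\<^sup>2 / 2) * (1 + \<sigma>\<^sup>2) - \<rho>\<^sup>2)) = 1 / (pi ^ 3 * (2 * \<sigma>\<^sup>2 * ((1 + \<sigma>\<^sup>2 / 2) * (1 + \<sigma>\<^sup>2) - \<rho>\<^sup>2)))"
    proof -
      have "1 / (pi * q) ^ 3 * (q / 2 * q / d) = 1 / (pi ^ 3 * (2 * q * d))" if "q > 0" for q d :: real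
        using that by (simp add: power3_eq_cube)
      then show ?thesis using s by blast
    qed
    finally show "expectation (\<lambda>\<omega>. ?f (p - (h1 \<omega>, h1 \<omega>, h2 \<omega>))) = ?g p"
      by (simp only: p fst_conv snd_conv)
    show "0 < ?g p" using D s by simp
  qed simp
  then show ?thesis by (simp add: x_def y_def w_def)
qed

text \<open>The exponents cancel in both mutual informations, as 1 + 2 - 3 = 0 and 1 + 1 - 2 = 0.
  The constants combine to C3 C1 / C2^2, which is the quotient of covariance determinants: (x, w)
  and (y, w) share the constant \<open>C2\<close>.\<close>

lemma secret_key_rate_eq:
  assumes b: "1 < b" and r: "\<rho>\<^sup>2 \<le> 1"
  shows "secret_key_rate b = log b (((1 + \<sigma>\<^sup>2)\<^sup>2 - \<rho>\<^sup>2)\<^sup>2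
     / ((1 + \<sigma>\<^sup>2) * (\<sigma> ^ 6 + 3 * \<sigma> ^ 4 - 2 * \<sigma>\<^sup>2 * \<rho>\<^sup>2 + 2 * \<sigma>\<^sup>2)))"
proof -
  interpret information_space M b
    by standard (rule b)
  define C1 C2 C3 where "C1 = 1 / (pi * (1 + \<sigma>\<^sup>2))" and "C2 = 1 / (pi\<^sup>2 * ((1 + \<sigma>\<^sup>2)\<^sup>2 - \<rho>\<^sup>2))"
    and "C3 = 1 / (pi ^ 3 * (2 * \<sigma>\<^sup>2 * ((1 + \<sigma>\<^sup>2 / 2) * (1 + \<sigma>\<^sup>2) - \<rho>\<^sup>2)))"
  have s: "0 < \<sigma>\<^sup>2" using sigma_pos by simp
  have D: "0 < (1 + \<sigma>\<^sup>2)\<^sup>2 - \<rho>\<^sup>2" "0 < (1 + \<sigma>\<^sup>2 / 2) * (1 + \<sigma>\<^sup>2) - \<rho>\<^sup>2"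
    using covariance_det_pos[OF s s r] covariance_det_pos[OF half_gt_zero[OF s] s r] by (simp_all add: power2_eq_square[of "1 + _"])
  have C: "0 < C1" "0 < C2" "0 < C3" using s D by (simp_all add: C1_def C2_def C3_def add_pos_pos)
  have [measurable]: "fst \<in> borel_measurable (borel :: (complex \<times> complex) measure)" "snd \<in> borel_measurable (borel :: (complex \<times> complex) measure)"
    "(\<lambda>p. fst (snd p)) \<in> borel_measurable (borel :: (complex \<times> complex \<times> complex) measure)" "(\<lambda>p. snd (snd p)) \<in> borel_measurable (borel :: (complex \<times> complex \<times> complex) measure)"
    "snd \<in> borel_measurable (borel :: (complex \<times> complex \<times> complex) measure)"
    "fst \<in> borel_measurable (borel :: (complex \<times> complex \<times> complex) measure)"
    by (auto intro!: borel_measurable_continuous_onI continuous_intros)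
  have dx: "distributed M lborel x (\<lambda>z. ennreal (C1 * exp (- ((norm z)\<^sup>2 / (1 + \<sigma>\<^sup>2)))))"
    using single_density[of h1 1 0, OF _ gain1_power _ n1_DL_moments(1)] indep_gains_noises[of fst fst]
    by (simp add: C1_def x_def[abs_def])
  have dw: "distributed M lborel w (\<lambda>z. ennreal (C1 * exp (- ((norm z)\<^sup>2 / (1 + \<sigma>\<^sup>2)))))"
    using single_density[of h2 0 1, OF _ gain2_power _ n2_DL_moments(1)] indep_gains_noises[of snd "\<lambda>p. snd (snd p)"]
    by (simp add: C1_def w_def[abs_def])
  have dxw: "distributed M lborel (\<lambda>\<omega>. (x \<omega>, w \<omega>)) (\<lambda>p. ennreal (C2 * exp (- gauss_form \<rho> (\<sigma>\<^sup>2) (\<sigma>\<^sup>2) (fst p) (snd p))))"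
    using pair_density[OF r _ indep_noises(3) n1_DL_moments(1)] indep_gains_noises[of "\<lambda>p. p" "\<lambda>p. (fst p, snd (snd p))"]
    by (simp add: C2_def x_def w_def borel_measurable_Pair)
  have dyw: "distributed M lborel (\<lambda>\<omega>. (y \<omega>, w \<omega>)) (\<lambda>p. ennreal (C2 * exp (- gauss_form \<rho> (\<sigma>\<^sup>2) (\<sigma>\<^sup>2) (fst p) (snd p))))"
    using pair_density[OF r _ indep_noises(4) n1_UL_moments(1)] indep_gains_noises[of "\<lambda>p. p" "\<lambda>p. (fst (snd p), snd (snd p))"]
    by (simp add: C2_def y_def w_def borel_measurable_Pair)
  let ?Q3 = "\<lambda>p. (norm (fst p - fst (snd p)))\<^sup>2 / (2 * \<sigma>\<^sup>2) + gauss_form \<rho> (\<sigma>\<^sup>2 / 2) (\<sigma>\<^sup>2) ((fst p + fst (snd p)) / 2) (snd (snd p))"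
  have dxyw: "distributed M lborel (\<lambda>\<omega>. (x \<omega>, y \<omega>, w \<omega>)) (\<lambda>p. ennreal (C3 * exp (- ?Q3 p)))"
    using triple_density[OF r] by (simp add: C3_def)
  note m = observation_moments
  have qx: "has_bochner_integral M (\<lambda>\<omega>. (norm (x \<omega>))\<^sup>2 / (1 + \<sigma>\<^sup>2)) 1"
    using has_bochner_integral_divide_zero[OF m(1), of "1 + \<sigma>\<^sup>2"] s unfolding norm_square_eq_Re by (simp add: add_pos_pos less_imp_neq[symmetric])
  have qw: "has_bochner_integral M (\<lambda>\<omega>. (norm (w \<omega>))\<^sup>2 / (1 + \<sigma>\<^sup>2)) 1"
    using has_bochner_integral_divide_zero[OF m(3), of "1 + \<sigma>\<^sup>2"] s unfolding norm_square_eq_Re by (simp add: add_pos_pos less_imp_neq[symmetric])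
  have qxw: "has_bochner_integral M (\<lambda>\<omega>. gauss_form \<rho> (\<sigma>\<^sup>2) (\<sigma>\<^sup>2) (x \<omega>) (w \<omega>)) 2"
    using D by (intro has_bochner_integral_gauss_form m) (simp add: power2_eq_square[of "1 + _"])
  have qyw: "has_bochner_integral M (\<lambda>\<omega>. gauss_form \<rho> (\<sigma>\<^sup>2) (\<sigma>\<^sup>2) (y \<omega>) (w \<omega>)) 2"
    using D by (intro has_bochner_integral_gauss_form m) (simp add: power2_eq_square[of "1 + _"])
  have qd: "has_bochner_integral M (\<lambda>\<omega>. (norm (x \<omega> - y \<omega>))\<^sup>2 / (2 * \<sigma>\<^sup>2)) 1"
  proof -
    have "has_bochner_integral M (\<lambda>\<omega>. (Re (x \<omega> * cnj (x \<omega>)) + Re (y \<omega> * cnj (y \<omega>)) - 2 * Re (x \<omega> * cnj (y \<omega>))) / (2 * \<sigma>\<^sup>2)) (((1 + \<sigma>\<^sup>2) + (1 + \<sigma>\<^sup>2) - 2 * 1) / (2 * \<sigma>\<^sup>2))"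
      by (intro has_bochner_integral_divide_zero has_bochner_integral_diff has_bochner_integral_add has_bochner_integral_mult_right m)
    also have "(\<lambda>\<omega>. (Re (x \<omega> * cnj (x \<omega>)) + Re (y \<omega> * cnj (y \<omega>)) - 2 * Re (x \<omega> * cnj (y \<omega>))) / (2 * \<sigma>\<^sup>2)) = (\<lambda>\<omega>. (norm (x \<omega> - y \<omega>))\<^sup>2 / (2 * \<sigma>\<^sup>2))"
      unfolding norm_square_eq_Re by (simp add: algebra_simps)
    finally show ?thesis using s by simp
  qed
  \<comment> \<open>The midpoint has variance \<open>1 + \<sigma>\<^sup>2 / 2\<close>, since the
    common gain survives averaging while the independent noises lose half of their variance; its
    correlation with \<open>w\<close> is still \<rho>.\<close>
  have qm: "has_bochner_integral M (\<lambda>\<omega>. gauss_form \<rho> (\<sigma>\<^sup>2 / 2) (\<sigma>\<^sup>2) ((x \<omega> + y \<omega>) / 2) (w \<omega>)) 2"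
  proof (rule has_bochner_integral_gauss_form[OF _ m(3) _ D(2)])
    have "has_bochner_integral M (\<lambda>\<omega>. (Re (x \<omega> * cnj (x \<omega>)) + Re (y \<omega> * cnj (y \<omega>)) + 2 * Re (x \<omega> * cnj (y \<omega>))) / 4) (((1 + \<sigma>\<^sup>2) + (1 + \<sigma>\<^sup>2) + 2 * 1) / 4)"
      by (intro has_bochner_integral_divide_zero has_bochner_integral_add has_bochner_integral_mult_right m)
    then show "has_bochner_integral M (\<lambda>\<omega>. Re ((x \<omega> + y \<omega>) / 2 * cnj ((x \<omega> + y \<omega>) / 2))) (1 + \<sigma>\<^sup>2 / 2)"
      by (rule back_subst[where P="\<lambda>f. has_bochner_integral M f _", THEN back_subst[where P="has_bochner_integral M _"]]) (simp_all add: fun_eq_iff field_simps)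
    have "has_bochner_integral M (\<lambda>\<omega>. (Re (x \<omega> * cnj (w \<omega>)) + Re (y \<omega> * cnj (w \<omega>))) / 2) ((\<rho> + \<rho>) / 2)"
      by (intro has_bochner_integral_divide_zero has_bochner_integral_add m)
    also have "(\<lambda>\<omega>. (Re (x \<omega> * cnj (w \<omega>)) + Re (y \<omega> * cnj (w \<omega>))) / 2) = (\<lambda>\<omega>. Re ((x \<omega> + y \<omega>) / 2 * cnj (w \<omega>)))"
      by (simp add: fun_eq_iff field_simps)
    finally show "has_bochner_integral M (\<lambda>\<omega>. Re ((x \<omega> + y \<omega>) / 2 * cnj (w \<omega>))) \<rho>" by simp
  qed
  have q1: "(\<lambda>z :: complex. (norm z)\<^sup>2 / (1 + \<sigma>\<^sup>2)) \<in> borel_measurable lborel"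
    by simp
  have q2: "(\<lambda>p. gauss_form \<rho> (\<sigma>\<^sup>2) (\<sigma>\<^sup>2) (fst p) (snd p)) \<in> borel_measurable lborel"
    unfolding measurable_lborel1 by measurable
  have q3: "?Q3 \<in> borel_measurable lborel"
    unfolding measurable_lborel1 by measurable
  have qxyw: "has_bochner_integral M (\<lambda>\<omega>. ?Q3 (x \<omega>, y \<omega>, w \<omega>)) (1 + 2)"
    using has_bochner_integral_add[OF qd qm] by simp
  have mi_xyw: "mutual_information b lborel lborel x (\<lambda>\<omega>. (y \<omega>, w \<omega>)) = log b (C3 / (C1 * C2)) + (1 + 2 - (1 + 2)) / ln b"
    by (rule mutual_information_exp_densities[where Cxy = C3 and Qxy = ?Q3, unfolded lborel_prod,
          OF sigma_finite_lborel sigma_finite_lborel dx dyw _ C q1 q2])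
      (use dxyw q3 qx qyw qxyw in \<open>simp_all add: lborel_prod\<close>)
  have mi_xw: "mutual_information b lborel lborel x w = log b (C2 / (C1 * C1)) + (1 + 1 - 2) / ln b"
    by (rule mutual_information_exp_densities[where Cxy = C2 and Qxy = "\<lambda>p. gauss_form \<rho> (\<sigma>\<^sup>2) (\<sigma>\<^sup>2) (fst p) (snd p)", unfolded lborel_prod,
          OF sigma_finite_lborel sigma_finite_lborel dx dw _ C(1,1,2) q1 q1])
      (use dxw q2 qx qw qxw in \<open>simp_all add: lborel_prod\<close>)
  have "mutual_information b borel (borel \<Otimes>\<^sub>M borel) x (\<lambda>\<omega>. (y \<omega>, w \<omega>)) = mutual_information b lborel lborel x (\<lambda>\<omega>. (y \<omega>, w \<omega>))"
    "mutual_information b borel borel x w = mutual_information b lborel lborel x w"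
    by (rule mutual_information_cong_sets; simp only: sets_lborel borel_prod)+
  then have "secret_key_rate b = log b (C3 / (C1 * C2)) - log b (C2 / (C1 * C1))"
    unfolding secret_key_rate_def conditional_mutual_information_def mi_xyw mi_xw by (simp only:) simp
  also have "\<dots> = log b (C3 / (C1 * C2) / (C2 / (C1 * C1)))"
    using C by (intro log_divide_pos[symmetric] divide_pos_pos mult_pos_pos)
  also have "C3 / (C1 * C2) / (C2 / (C1 * C1)) = C3 * C1 / C2\<^sup>2"
    using C by (simp add: power2_eq_square)
  also have "\<dots> = ((1 + \<sigma>\<^sup>2)\<^sup>2 - \<rho>\<^sup>2)\<^sup>2 / ((1 + \<sigma>\<^sup>2) * (2 * \<sigma>\<^sup>2 * ((1 + \<sigma>\<^sup>2 / 2) * (1 + \<sigma>\<^sup>2) - \<rho>\<^sup>2)))"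
  proof -
    have "1 / (pi ^ 3 * e) * (1 / (pi * q)) / (1 / (pi\<^sup>2 * d))\<^sup>2 = d\<^sup>2 / (q * e)" for q d e :: real
      by (simp add: power2_eq_square power3_eq_cube)
    then show ?thesis unfolding C1_def C2_def C3_def by blast
  qed
  \<comment> \<open>Expanding the determinant of the triple gives the polynomial of the
    claim.\<close>
  also have "2 * \<sigma>\<^sup>2 * ((1 + \<sigma>\<^sup>2 / 2) * (1 + \<sigma>\<^sup>2) - \<rho>\<^sup>2) = \<sigma> ^ 6 + 3 * \<sigma> ^ 4 - 2 * \<sigma>\<^sup>2 * \<rho>\<^sup>2 + 2 * \<sigma>\<^sup>2"
    by (simp add: field_simps power2_eq_square eval_nat_numeral)
  finally show ?thesis .
qed

end

theorem theorem3:
  fixes M :: "'a measure" and M' :: "'b measure"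
    and h1 h2 n1_DL n1_UL n2_DL :: "'a \<Rightarrow> complex"
    and h1' h2' n1_DL' n1_UL' n2_DL' :: "'b \<Rightarrow> complex"
    and \<rho> \<sigma> b R\<^sub>1 R\<^sub>h :: real
  assumes "1 < b" and "\<rho> \<in> {-1..1}" and "0 < \<sigma>"
    and "overlapping_beam M \<rho> \<sigma> h1 h2 n1_DL n1_UL n2_DL"
    and "overlapping_beam M' 0 \<sigma> h1' h2' n1_DL' n1_UL' n2_DL'"
  defines "R\<^sub>1 \<equiv> overlapping_beam.secret_key_rate M h1 h2 n1_DL n1_UL n2_DL b"
    and "R\<^sub>h \<equiv> overlapping_beam.secret_key_rate M' h1' h2' n1_DL' n1_UL' n2_DL' b"
  shows "leakage_ratio R\<^sub>h R\<^sub>1 =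
    1 - log b (((1 + \<sigma>\<^sup>2)\<^sup>2 - \<rho>\<^sup>2)\<^sup>2
               / ((1 + \<sigma>\<^sup>2) * (\<sigma>^6 + 3 * \<sigma>^4 - 2 * \<sigma>\<^sup>2 * \<rho>\<^sup>2 + 2 * \<sigma>\<^sup>2)))
        / log b ((1 + \<sigma>\<^sup>2)\<^sup>2 / (\<sigma>\<^sup>2 * (2 + \<sigma>\<^sup>2)))"
proof -
  have s: "0 < \<sigma>\<^sup>2" using assms(3) by simp
  have "\<rho>\<^sup>2 \<le> 1" using assms(2) by (simp add: abs_square_le_1 abs_le_iff)
  note R1 = overlapping_beam.secret_key_rate_eq[OF assms(4,1) this]
  \<comment> \<open>Independent channels form another beam with correlation 0, so the same formula
    applies there.\<close>
  have "R\<^sub>h = log b (((1 + \<sigma>\<^sup>2)\<^sup>2 - 0\<^sup>2)\<^sup>2 / ((1 + \<sigma>\<^sup>2) * (\<sigma>^6 + 3 * \<sigma>^4 - 2 * \<sigma>\<^sup>2 * 0\<^sup>2 + 2 * \<sigma>\<^sup>2)))"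
    unfolding R\<^sub>h_def by (rule overlapping_beam.secret_key_rate_eq[OF assms(5,1)]) simp
  also have "((1 + \<sigma>\<^sup>2)\<^sup>2 - 0\<^sup>2)\<^sup>2 / ((1 + \<sigma>\<^sup>2) * (\<sigma>^6 + 3 * \<sigma>^4 - 2 * \<sigma>\<^sup>2 * 0\<^sup>2 + 2 * \<sigma>\<^sup>2)) =
      (1 + \<sigma>\<^sup>2)\<^sup>2 / (\<sigma>\<^sup>2 * (2 + \<sigma>\<^sup>2))"
  proof -
    \<comment> \<open>At \<rho> = 0 the polynomial has a factor \<open>1 + \<sigma>\<^sup>2\<close>;
      together with the one already present it reduces the fourth power in the numerator to a
      square.\<close>
    have "\<sigma>^6 + 3 * \<sigma>^4 + 2 * \<sigma>\<^sup>2 = (1 + \<sigma>\<^sup>2) * (\<sigma>\<^sup>2 * (2 + \<sigma>\<^sup>2))"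
      by (simp add: algebra_simps power2_eq_square eval_nat_numeral)
    moreover have "1 + \<sigma>\<^sup>2 \<noteq> 0" using s by linarith
    ultimately show ?thesis by (simp add: power2_eq_square)
  qed
  finally have Rh: "R\<^sub>h = log b ((1 + \<sigma>\<^sup>2)\<^sup>2 / (\<sigma>\<^sup>2 * (2 + \<sigma>\<^sup>2)))" .
  \<comment> \<open>The two sides differ by exactly 1. Hence \<open>R\<^sub>h\<close> is positive,
    and \<open>R\<^sub>h / R\<^sub>h\<close> equals 1 in the leakage ratio.\<close>
  have "\<sigma>\<^sup>2 * (2 + \<sigma>\<^sup>2) < (1 + \<sigma>\<^sup>2)\<^sup>2" "0 < \<sigma>\<^sup>2 * (2 + \<sigma>\<^sup>2)"
    using s by (simp_all add: power2_sum algebra_simps power2_eq_square[of "\<sigma>\<^sup>2"] add_pos_pos)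
  then have "1 < (1 + \<sigma>\<^sup>2)\<^sup>2 / (\<sigma>\<^sup>2 * (2 + \<sigma>\<^sup>2))"
    by (simp only: less_divide_eq_1_pos)
  then have "0 < R\<^sub>h"
    unfolding Rh using assms(1) by simp
  then show ?thesis
    unfolding leakage_ratio_def R1[folded R\<^sub>1_def, symmetric] Rh[symmetric] by (simp add: diff_divide_distrib)
qed

end
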